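(* Let $\mathcal C$ be a category such that (A1) $\mathcal C$ is an abelian category; (A2) $\mathcal C$ has a braided monoidal structure with product $\otimes$, unit $1$, associativity $\alpha^\otimes_{A,B,C}:(A\otimes B)\otimes C\to A\otimes(B\otimes C)$, unit isomorphisms $\lambda^\otimes_A:1\otimes A\to A$, $\rho^\otimes_A:A\otimes 1\to A$, and braiding $\gamma^\otimes_{A,B}:A\otimes B\to B\otimes A$; (A3) the bifunctor $\otimes$ is additive in each of its two arguments. Let $0$ be the zero object, $\oplus$ the biproduct of $\mathcal C$, and let the natural isomorphisms $\alpha^\oplus_{A,B,C}:(A\oplus B)\oplus C\to A\oplus(B\oplus C)$, $\lambda^\oplus_A:0\oplus A\to A$, $\rho^\oplus_A:A\oplus 0\to A$, $\gamma^\oplus_{A,B}:A\oplus B\to B\oplus A$, $\delta_{A,B,C}:A\otimes(B\oplus C)\to(A\otimes B)\oplus(A\otimes C)$, $\varepsilon_A:A\otimes 0\to 0$ be the canonical ones defined in the context by means of the biproduct projections. Then $\alpha^\oplus,\lambda^\oplus,\rho^\oplus,\gamma^\oplus,\alpha^\otimes,\lambda^\otimes,\rho^\otimes,\gamma^\otimes,\delta,\varepsilon$ satisfy all the BD axioms (1)--(18) listed in the context.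
   Context: Composition is written left to right: $f;g$ means first $f$, then $g$. $XY$ abbreviates $X\otimes Y$, and $\otimes$ binds more tightly than $\oplus$. Canonical isomorphisms. For objects $A,B$, let $p_{A,B,1}:A\oplus B\to A$ and $p_{A,B,2}:A\oplus B\to B$ be the projections of the chosen biproduct $A\oplus B$; $\oplus$ acts on morphisms as the product bifunctor. - $\lambda^\oplus_A=p_{0,A,2}$ and $\rho^\oplus_A=p_{A,0,1}$. - $\gamma^\oplus_{A,B}$ is determined by $\gamma^\oplus_{A,B};p_{B,A,1}=p_{A,B,2}$ and $\gamma^\oplus_{A,B};p_{B,A,2}=p_{A,B,1}$. - $\alpha^\oplus_{A,B,C}$ is determined by $\alpha^\oplus_{A,B,C};p_{A,B\oplus C,1}=p_{A\oplus B,C,1};p_{A,B,1}$, $\ \alpha^\oplus_{A,B,C};p_{A,B\oplus C,2};p_{B,C,1}=p_{A\oplus B,C,1};p_{A,B,2}$, $\ \alpha^\oplus_{A,B,C};p_{A,B\oplus C,2};p_{B,C,2}=p_{A\oplus B,C,2}$. - $\delta_{A,B,C}$ is determined by $\delta_{A,B,C};p_{A\otimes B,A\otimes C,1}=1_A\otimes p_{B,C,1}$ and $\delta_{A,B,C};p_{A\otimes B,A\otimes C,2}=1_A\otimes p_{B,C,2}$ (it is an isomorphism because $A\otimes-$ is additive and so preserves biproducts). - $\varepsilon_A$ is the unique morphism $A\otimes 0\to 0$ to the zero object (an isomorphism because $A\otimes-$ is additive). BD axioms, for all objects $A,B,C,D$. Notation: $\beta_{X,Y}=\gamma^\otimes_{X,Y};\gamma^\otimes_{Y,X}:X\otimes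 Y\to X\otimes Y$, and $$\sigma_{A,B,C,D}=(\alpha^\oplus_{AC\oplus AD,BC,BD})^{-1};(\alpha^\oplus_{AC,AD,BC}\oplus 1_{BD});\big((1_{AC}\oplus\gamma^\oplus_{BC,AD})\oplus 1_{BD}\big)^{-1};(\alpha^\oplus_{AC,BC,AD}\oplus 1_{BD})^{-1};\alpha^\oplus_{AC\oplus BC,AD,BD},$$ an isomorphism $(AC\oplus AD)\oplus(BC\oplus BD)\to(AC\oplus BC)\oplus(AD\oplus BD)$. (1) $\alpha^\oplus_{A\oplus B,C,D};\alpha^\oplus_{A,B,C\oplus D}=(\alpha^\oplus_{A,B,C}\oplus 1_D);\alpha^\oplus_{A,B\oplus C,D};(1_A\oplus\alpha^\oplus_{B,C,D})$. (2) $\alpha^\oplus_{A,B,C};\gamma^\oplus_{A,B\oplus C};\alpha^\oplus_{B,C,A}=(\gamma^\oplus_{A,B}\oplus 1_C);\alpha^\oplus_{B,A,C};(1_B\oplus\gamma^\oplus_{A,C})$. (3) $\alpha^\oplus_{A,0,B};(1_A\oplus\lambda^\oplus_B)=\rho^\oplus_A\oplus 1_B$. (4) $\gamma^\oplus_{A,B};\gamma^\oplus_{B,A}=1_{A\oplus B}$. (5) $\alpha^\otimes_{AB,C,D};\alpha^\otimes_{A,B,CD}=(\alpha^\otimes_{A,B,C}\otimes 1_D);\alpha^\otimes_{A,BC,D};(1_A\otimes\alpha^\otimes_{B,C,D})$. (6) $\alpha^\otimes_{A,B,C};\gamma^\otimes_{A,BC};\alpha^\otimes_{B,C,A}=(\gamma^\otimes_{A,B}\otimes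 1_C);\alpha^\otimes_{B,A,C};(1_B\otimes\gamma^\otimes_{A,C})$. (7) $\alpha^\otimes_{A,B,C};(\gamma^\otimes_{BC,A})^{-1};\alpha^\otimes_{B,C,A}=((\gamma^\otimes_{B,A})^{-1}\otimes 1_C);\alpha^\otimes_{B,A,C};(1_B\otimes(\gamma^\otimes_{C,A})^{-1})$. (8) $\alpha^\otimes_{A,1,B};(1_A\otimes\lambda^\otimes_B)=\rho^\otimes_A\otimes 1_B$. (9) $\delta_{A,B,C};(\beta_{A,B}\oplus\beta_{A,C})=\beta_{A,B\oplus C};\delta_{A,B,C}$, and $\beta_{A,0}=1_{A\otimes 0}$. (10) $\delta_{A,B,C}=(1_A\otimes\gamma^\oplus_{B,C});\delta_{A,C,B};\gamma^\oplus_{AC,AB}$. (11) $(1_A\otimes\alpha^\oplus_{B,C,D});\delta_{A,B,C\oplus D};(1_{AB}\oplus\delta_{A,C,D})=\delta_{A,B\oplus C,D};(\delta_{A,B,C}\oplus 1_{AD});\alpha^\oplus_{AB,AC,AD}$. (12) $\delta_{A,B,0};(1_{AB}\oplus\varepsilon_A);\rho^\oplus_{AB}=1_A\otimes\rho^\oplus_B$. (13) $\alpha^\otimes_{A,B,C\oplus D};(1_A\otimes\delta_{B,C,D});\delta_{A,BC,BD}=\delta_{AB,C,D};(\alpha^\otimes_{A,B,C}\oplus\alpha^\otimes_{A,B,D})$. (14) $\varepsilon_{AB}=\alpha^\otimes_{A,B,0};(1_A\otimes\varepsilon_B);\varepsilon_A$. (15) $\delta_{1,A,B};(\lambda^\otimes_A\oplus\lambda^\otimes_B)=\lambda^\otimes_{A\oplus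 B}$. (16) $\varepsilon_1=\lambda^\otimes_0$. (17) $\gamma^\otimes_{A\oplus B,C\oplus D};\delta_{C\oplus D,A,B};(\gamma^\otimes_{A,C\oplus D}\oplus\gamma^\otimes_{B,C\oplus D})^{-1};(\delta_{A,C,D}\oplus\delta_{B,C,D});\sigma_{A,B,C,D}=\delta_{A\oplus B,C,D};(\gamma^\otimes_{A\oplus B,C}\oplus\gamma^\otimes_{A\oplus B,D});(\delta_{C,A,B}\oplus\delta_{D,A,B});\big((\gamma^\otimes_{A,C}\oplus\gamma^\otimes_{B,C})\oplus(\gamma^\otimes_{A,D}\oplus\gamma^\otimes_{B,D})\big)^{-1}$. (18) $\varepsilon_{A\oplus B}=\gamma^\otimes_{A\oplus B,0};\delta_{0,A,B};(\gamma^\otimes_{A,0}\oplus\gamma^\otimes_{B,0})^{-1};(\varepsilon_A\oplus\varepsilon_B);\lambda^\oplus_0$, and $\gamma^\otimes_{0,0}=1_{0\otimes 0}$. *)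

theory Defs
  imports "HOL-Algebra.Group"
begin

no_notation mult (infixl \<open>\<otimes>\<index>\<close> 70)
no_notation one (\<open>\<one>\<index>\<close>)

text \<open>Composition is in diagrammatic order: \<open>f \<Zsemi> g\<close> is first \<open>f\<close>, then \<open>g\<close>.\<close>

record ('o, 'm) cat =
  Obj :: "'o set"
  Arr :: "'m set"
  Dom :: "'m \<Rightarrow> 'o"
  Cod :: "'m \<Rightarrow> 'o"
  Ident :: "'o \<Rightarrow> 'm" (\<open>\<one>\<index>\<close>)
  Comp :: "'m \<Rightarrow> 'm \<Rightarrow> 'm" (infixl \<open>\<Zsemi>\<index>\<close> 55)

definition Hom :: "('o, 'm, 'x) cat_scheme \<Rightarrow> 'o \<Rightarrow> 'o \<Rightarrow> 'm set" (\<open>Hom\<index>\<close>) where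
  "Hom\<^bsub>\<C>\<^esub> A B = {f \<in> Arr \<C>. Dom \<C> f = A \<and> Cod \<C> f = B}"

locale category =
  fixes \<C> :: "('o, 'm, 'x) cat_scheme" (structure)
  assumes Dom_Obj: "f \<in> Arr \<C> \<Longrightarrow> Dom \<C> f \<in> Obj \<C>"
    and Cod_Obj: "f \<in> Arr \<C> \<Longrightarrow> Cod \<C> f \<in> Obj \<C>"
    and Ident_Hom: "A \<in> Obj \<C> \<Longrightarrow> \<one> A \<in> Hom A A"
    and Comp_Hom: "\<lbrakk>f \<in> Hom A B; g \<in> Hom B C\<rbrakk> \<Longrightarrow> f \<Zsemi> g \<in> Hom A C"
    and Ident_Comp: "f \<in> Hom A B \<Longrightarrow> \<one> A \<Zsemi> f = f"
    and Comp_Ident: "f \<in> Hom A B \<Longrightarrow> f \<Zsemi> \<one> B = f"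
    and Comp_assoc:
      "\<lbrakk>f \<in> Hom A B; g \<in> Hom B C; h \<in> Hom C D\<rbrakk> \<Longrightarrow> (f \<Zsemi> g) \<Zsemi> h = f \<Zsemi> (g \<Zsemi> h)"

definition iso_arr :: "('o, 'm, 'x) cat_scheme \<Rightarrow> 'o \<Rightarrow> 'o \<Rightarrow> 'm \<Rightarrow> bool" where
  "iso_arr \<C> A B f \<longleftrightarrow> f \<in> Hom\<^bsub>\<C>\<^esub> A B \<and>
     (\<exists>g \<in> Hom\<^bsub>\<C>\<^esub> B A. f \<Zsemi>\<^bsub>\<C>\<^esub> g = \<one>\<^bsub>\<C>\<^esub> A \<and> g \<Zsemi>\<^bsub>\<C>\<^esub> f = \<one>\<^bsub>\<C>\<^esub> B)"

definition inverse_arr :: "('o, 'm, 'x) cat_scheme \<Rightarrow> 'm \<Rightarrow> 'm" (\<open>(_\<^sup>-\<^sup>1\<index>)\<close> [1000] 999) where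
  "f\<^sup>-\<^sup>1\<^bsub>\<C>\<^esub> = (THE g. g \<in> Hom\<^bsub>\<C>\<^esub> (Cod \<C> f) (Dom \<C> f) \<and>
     f \<Zsemi>\<^bsub>\<C>\<^esub> g = \<one>\<^bsub>\<C>\<^esub> (Dom \<C> f) \<and> g \<Zsemi>\<^bsub>\<C>\<^esub> f = \<one>\<^bsub>\<C>\<^esub> (Cod \<C> f))"

definition mono_arr :: "('o, 'm, 'x) cat_scheme \<Rightarrow> 'm \<Rightarrow> bool" where
  "mono_arr \<C> f \<longleftrightarrow> f \<in> Arr \<C> \<and>
     (\<forall>X. \<forall>u \<in> Hom\<^bsub>\<C>\<^esub> X (Dom \<C> f). \<forall>v \<in> Hom\<^bsub>\<C>\<^esub> X (Dom \<C> f).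
        u \<Zsemi>\<^bsub>\<C>\<^esub> f = v \<Zsemi>\<^bsub>\<C>\<^esub> f \<longrightarrow> u = v)"

definition epi_arr :: "('o, 'm, 'x) cat_scheme \<Rightarrow> 'm \<Rightarrow> bool" where
  "epi_arr \<C> f \<longleftrightarrow> f \<in> Arr \<C> \<and>
     (\<forall>X. \<forall>u \<in> Hom\<^bsub>\<C>\<^esub> (Cod \<C> f) X. \<forall>v \<in> Hom\<^bsub>\<C>\<^esub> (Cod \<C> f) X.
        f \<Zsemi>\<^bsub>\<C>\<^esub> u = f \<Zsemi>\<^bsub>\<C>\<^esub> v \<longrightarrow> u = v)"

definition zero_object :: "('o, 'm, 'x) cat_scheme \<Rightarrow> 'o \<Rightarrow> bool" where
  "zero_object \<C> Z \<longleftrightarrow> Z \<in> Obj \<C> \<and>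
     (\<forall>A \<in> Obj \<C>. (\<exists>!f. f \<in> Hom\<^bsub>\<C>\<^esub> Z A) \<and> (\<exists>!f. f \<in> Hom\<^bsub>\<C>\<^esub> A Z))"

record ('o, 'm) preadd_cat = "('o, 'm) cat" +
  Add :: "'m \<Rightarrow> 'm \<Rightarrow> 'm" (infixl \<open>\<boxplus>\<index>\<close> 52)
  ZeroM :: "'o \<Rightarrow> 'o \<Rightarrow> 'm"

definition hom_group :: "('o, 'm, 'x) preadd_cat_scheme \<Rightarrow> 'o \<Rightarrow> 'o \<Rightarrow> 'm monoid" where
  "hom_group \<C> A B = \<lparr>carrier = Hom\<^bsub>\<C>\<^esub> A B, mult = Add \<C>, one = ZeroM \<C> A B\<rparr>"

locale preadditive_category = category \<C>
  for \<C> :: "('o, 'm, 'x) preadd_cat_scheme" (structure) +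
  assumes hom_comm_group: "\<lbrakk>A \<in> Obj \<C>; B \<in> Obj \<C>\<rbrakk> \<Longrightarrow> comm_group (hom_group \<C> A B)"
    and Comp_Add: "\<lbrakk>f \<in> Hom A B; g \<in> Hom B C; h \<in> Hom B C\<rbrakk>
      \<Longrightarrow> f \<Zsemi> (g \<boxplus> h) = (f \<Zsemi> g) \<boxplus> (f \<Zsemi> h)"
    and Add_Comp: "\<lbrakk>f \<in> Hom A B; g \<in> Hom A B; h \<in> Hom B C\<rbrakk>
      \<Longrightarrow> (f \<boxplus> g) \<Zsemi> h = (f \<Zsemi> h) \<boxplus> (g \<Zsemi> h)"

text \<open>The equations \<open>i1 \<Zsemi> p2 = 0\<close> and \<open>i2 \<Zsemi> p1 = 0\<close>, and the universal properties of product and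
  coproduct, follow from the three equations below in a preadditive category.\<close>

definition is_biproduct ::
    "('o, 'm, 'x) preadd_cat_scheme \<Rightarrow> 'o \<Rightarrow> 'o \<Rightarrow> 'o \<Rightarrow> 'm \<Rightarrow> 'm \<Rightarrow> 'm \<Rightarrow> 'm \<Rightarrow> bool" where
  "is_biproduct \<C> A B S p1 p2 i1 i2 \<longleftrightarrow> S \<in> Obj \<C> \<and>
     p1 \<in> Hom\<^bsub>\<C>\<^esub> S A \<and> p2 \<in> Hom\<^bsub>\<C>\<^esub> S B \<and> i1 \<in> Hom\<^bsub>\<C>\<^esub> A S \<and> i2 \<in> Hom\<^bsub>\<C>\<^esub> B S \<and>
     i1 \<Zsemi>\<^bsub>\<C>\<^esub> p1 = \<one>\<^bsub>\<C>\<^esub> A \<and> i2 \<Zsemi>\<^bsub>\<C>\<^esub> p2 = \<one>\<^bsub>\<C>\<^esub> B \<and>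
     (p1 \<Zsemi>\<^bsub>\<C>\<^esub> i1) \<boxplus>\<^bsub>\<C>\<^esub> (p2 \<Zsemi>\<^bsub>\<C>\<^esub> i2) = \<one>\<^bsub>\<C>\<^esub> S"

definition is_kernel :: "('o, 'm, 'x) preadd_cat_scheme \<Rightarrow> 'm \<Rightarrow> 'm \<Rightarrow> bool" where
  "is_kernel \<C> f k \<longleftrightarrow> f \<in> Arr \<C> \<and> k \<in> Arr \<C> \<and> Cod \<C> k = Dom \<C> f \<and>
     k \<Zsemi>\<^bsub>\<C>\<^esub> f = ZeroM \<C> (Dom \<C> k) (Cod \<C> f) \<and>
     (\<forall>X. \<forall>h \<in> Hom\<^bsub>\<C>\<^esub> X (Dom \<C> f). h \<Zsemi>\<^bsub>\<C>\<^esub> f = ZeroM \<C> X (Cod \<C> f) \<longrightarrow>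
        (\<exists>!u. u \<in> Hom\<^bsub>\<C>\<^esub> X (Dom \<C> k) \<and> u \<Zsemi>\<^bsub>\<C>\<^esub> k = h))"

definition is_cokernel :: "('o, 'm, 'x) preadd_cat_scheme \<Rightarrow> 'm \<Rightarrow> 'm \<Rightarrow> bool" where
  "is_cokernel \<C> f q \<longleftrightarrow> f \<in> Arr \<C> \<and> q \<in> Arr \<C> \<and> Dom \<C> q = Cod \<C> f \<and>
     f \<Zsemi>\<^bsub>\<C>\<^esub> q = ZeroM \<C> (Dom \<C> f) (Cod \<C> q) \<and>
     (\<forall>X. \<forall>h \<in> Hom\<^bsub>\<C>\<^esub> (Cod \<C> f) X. f \<Zsemi>\<^bsub>\<C>\<^esub> h = ZeroM \<C> (Dom \<C> f) X \<longrightarrow>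
        (\<exists>!u. u \<in> Hom\<^bsub>\<C>\<^esub> (Cod \<C> q) X \<and> q \<Zsemi>\<^bsub>\<C>\<^esub> u = h))"

locale abelian_category = preadditive_category \<C>
  for \<C> :: "('o, 'm, 'x) preadd_cat_scheme" (structure) +
  assumes ex_zero_object: "\<exists>Z. zero_object \<C> Z"
    and ex_biproduct: "\<lbrakk>A \<in> Obj \<C>; B \<in> Obj \<C>\<rbrakk> \<Longrightarrow> \<exists>S p1 p2 i1 i2. is_biproduct \<C> A B S p1 p2 i1 i2"
    and ex_kernel: "f \<in> Arr \<C> \<Longrightarrow> \<exists>k. is_kernel \<C> f k"
    and ex_cokernel: "f \<in> Arr \<C> \<Longrightarrow> \<exists>q. is_cokernel \<C> f q"
    and mono_is_kernel: "mono_arr \<C> f \<Longrightarrow> \<exists>g. is_kernel \<C> g f"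
    and epi_is_cokernel: "epi_arr \<C> f \<Longrightarrow> \<exists>g. is_cokernel \<C> g f"

record ('o, 'm) biprod_cat = "('o, 'm) preadd_cat" +
  ZeroO :: 'o (\<open>\<zero>\<index>\<close>)
  SumO :: "'o \<Rightarrow> 'o \<Rightarrow> 'o" (infixl \<open>\<oplus>\<index>\<close> 65)
  Pr1 :: "'o \<Rightarrow> 'o \<Rightarrow> 'm" (\<open>p\<^sub>1\<index>\<close>)
  Pr2 :: "'o \<Rightarrow> 'o \<Rightarrow> 'm" (\<open>p\<^sub>2\<index>\<close>)
  In1 :: "'o \<Rightarrow> 'o \<Rightarrow> 'm"
  In2 :: "'o \<Rightarrow> 'o \<Rightarrow> 'm"

locale chosen_biproducts =
  fixes \<C> :: "('o, 'm, 'x) biprod_cat_scheme" (structure)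
  assumes zero_object_ZeroO: "zero_object \<C> \<zero>"
    and is_biproduct_SumO: "\<lbrakk>A \<in> Obj \<C>; B \<in> Obj \<C>\<rbrakk> \<Longrightarrow>
      is_biproduct \<C> A B (A \<oplus> B) (p\<^sub>1 A B) (p\<^sub>2 A B) (In1 \<C> A B) (In2 \<C> A B)"

definition SumM :: "('o, 'm, 'x) biprod_cat_scheme \<Rightarrow> 'm \<Rightarrow> 'm \<Rightarrow> 'm" (infixl \<open>\<oplus>\<^sub>m\<index>\<close> 65) where
  "f \<oplus>\<^sub>m\<^bsub>\<C>\<^esub> g =
     (let A = Dom \<C> f; B = Dom \<C> g; A' = Cod \<C> f; B' = Cod \<C> g in
      THE h. h \<in> Hom\<^bsub>\<C>\<^esub> (A \<oplus>\<^bsub>\<C>\<^esub> B) (A' \<oplus>\<^bsub>\<C>\<^esub> B') \<and>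
        h \<Zsemi>\<^bsub>\<C>\<^esub> p\<^sub>1\<^bsub>\<C>\<^esub> A' B' = p\<^sub>1\<^bsub>\<C>\<^esub> A B \<Zsemi>\<^bsub>\<C>\<^esub> f \<and>
        h \<Zsemi>\<^bsub>\<C>\<^esub> p\<^sub>2\<^bsub>\<C>\<^esub> A' B' = p\<^sub>2\<^bsub>\<C>\<^esub> A B \<Zsemi>\<^bsub>\<C>\<^esub> g)"

definition lunitS :: "('o, 'm, 'x) biprod_cat_scheme \<Rightarrow> 'o \<Rightarrow> 'm" (\<open>\<lambda>\<^sup>\<oplus>\<index>\<close>) where
  "\<lambda>\<^sup>\<oplus>\<^bsub>\<C>\<^esub> A = p\<^sub>2\<^bsub>\<C>\<^esub> \<zero>\<^bsub>\<C>\<^esub> A"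

definition runitS :: "('o, 'm, 'x) biprod_cat_scheme \<Rightarrow> 'o \<Rightarrow> 'm" (\<open>\<rho>\<^sup>\<oplus>\<index>\<close>) where
  "\<rho>\<^sup>\<oplus>\<^bsub>\<C>\<^esub> A = p\<^sub>1\<^bsub>\<C>\<^esub> A \<zero>\<^bsub>\<C>\<^esub>"

definition symS :: "('o, 'm, 'x) biprod_cat_scheme \<Rightarrow> 'o \<Rightarrow> 'o \<Rightarrow> 'm" (\<open>\<gamma>\<^sup>\<oplus>\<index>\<close>) where
  "\<gamma>\<^sup>\<oplus>\<^bsub>\<C>\<^esub> A B =
     (THE h. h \<in> Hom\<^bsub>\<C>\<^esub> (A \<oplus>\<^bsub>\<C>\<^esub> B) (B \<oplus>\<^bsub>\<C>\<^esub> A) \<and>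
        h \<Zsemi>\<^bsub>\<C>\<^esub> p\<^sub>1\<^bsub>\<C>\<^esub> B A = p\<^sub>2\<^bsub>\<C>\<^esub> A B \<and>
        h \<Zsemi>\<^bsub>\<C>\<^esub> p\<^sub>2\<^bsub>\<C>\<^esub> B A = p\<^sub>1\<^bsub>\<C>\<^esub> A B)"

definition assocS :: "('o, 'm, 'x) biprod_cat_scheme \<Rightarrow> 'o \<Rightarrow> 'o \<Rightarrow> 'o \<Rightarrow> 'm" (\<open>\<alpha>\<^sup>\<oplus>\<index>\<close>) where
  "\<alpha>\<^sup>\<oplus>\<^bsub>\<C>\<^esub> A B C =
     (THE h. h \<in> Hom\<^bsub>\<C>\<^esub> ((A \<oplus>\<^bsub>\<C>\<^esub> B) \<oplus>\<^bsub>\<C>\<^esub> C) (A \<oplus>\<^bsub>\<C>\<^esub> (B \<oplus>\<^bsub>\<C>\<^esub> C)) \<and>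
        h \<Zsemi>\<^bsub>\<C>\<^esub> p\<^sub>1\<^bsub>\<C>\<^esub> A (B \<oplus>\<^bsub>\<C>\<^esub> C) = p\<^sub>1\<^bsub>\<C>\<^esub> (A \<oplus>\<^bsub>\<C>\<^esub> B) C \<Zsemi>\<^bsub>\<C>\<^esub> p\<^sub>1\<^bsub>\<C>\<^esub> A B \<and>
        h \<Zsemi>\<^bsub>\<C>\<^esub> p\<^sub>2\<^bsub>\<C>\<^esub> A (B \<oplus>\<^bsub>\<C>\<^esub> C) \<Zsemi>\<^bsub>\<C>\<^esub> p\<^sub>1\<^bsub>\<C>\<^esub> B C = p\<^sub>1\<^bsub>\<C>\<^esub> (A \<oplus>\<^bsub>\<C>\<^esub> B) C \<Zsemi>\<^bsub>\<C>\<^esub> p\<^sub>2\<^bsub>\<C>\<^esub> A B \<and>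
        h \<Zsemi>\<^bsub>\<C>\<^esub> p\<^sub>2\<^bsub>\<C>\<^esub> A (B \<oplus>\<^bsub>\<C>\<^esub> C) \<Zsemi>\<^bsub>\<C>\<^esub> p\<^sub>2\<^bsub>\<C>\<^esub> B C = p\<^sub>2\<^bsub>\<C>\<^esub> (A \<oplus>\<^bsub>\<C>\<^esub> B) C)"

record ('o, 'm) bimonoidal_cat = "('o, 'm) biprod_cat" +
  TensorO :: "'o \<Rightarrow> 'o \<Rightarrow> 'o" (infixl \<open>\<otimes>\<index>\<close> 70)
  TensorM :: "'m \<Rightarrow> 'm \<Rightarrow> 'm" (infixl \<open>\<otimes>\<^sub>m\<index>\<close> 70)
  UnitO :: 'o (\<open>\<I>\<index>\<close>)
  assocT :: "'o \<Rightarrow> 'o \<Rightarrow> 'o \<Rightarrow> 'm" (\<open>\<alpha>\<^sup>\<otimes>\<index>\<close>)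
  lunitT :: "'o \<Rightarrow> 'm" (\<open>\<lambda>\<^sup>\<otimes>\<index>\<close>)
  runitT :: "'o \<Rightarrow> 'm" (\<open>\<rho>\<^sup>\<otimes>\<index>\<close>)
  braidT :: "'o \<Rightarrow> 'o \<Rightarrow> 'm" (\<open>\<gamma>\<^sup>\<otimes>\<index>\<close>)

locale monoidal_category = category \<C>
  for \<C> :: "('o, 'm, 'x) bimonoidal_cat_scheme" (structure) +
  assumes UnitO_Obj: "\<I> \<in> Obj \<C>"
    and TensorO_Obj: "\<lbrakk>A \<in> Obj \<C>; B \<in> Obj \<C>\<rbrakk> \<Longrightarrow> A \<otimes> B \<in> Obj \<C>"
    and TensorM_Hom: "\<lbrakk>f \<in> Hom A A'; g \<in> Hom B B'\<rbrakk> \<Longrightarrow> f \<otimes>\<^sub>m g \<in> Hom (A \<otimes> B) (A' \<otimes> B')"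
    and TensorM_Ident: "\<lbrakk>A \<in> Obj \<C>; B \<in> Obj \<C>\<rbrakk> \<Longrightarrow> \<one> A \<otimes>\<^sub>m \<one> B = \<one> (A \<otimes> B)"
    and TensorM_Comp:
      "\<lbrakk>f \<in> Hom A A'; f' \<in> Hom A' A''; g \<in> Hom B B'; g' \<in> Hom B' B''\<rbrakk>
        \<Longrightarrow> (f \<Zsemi> f') \<otimes>\<^sub>m (g \<Zsemi> g') = (f \<otimes>\<^sub>m g) \<Zsemi> (f' \<otimes>\<^sub>m g')"
    and assocT_iso: "\<lbrakk>A \<in> Obj \<C>; B \<in> Obj \<C>; C \<in> Obj \<C>\<rbrakk>
        \<Longrightarrow> iso_arr \<C> ((A \<otimes> B) \<otimes> C) (A \<otimes> (B \<otimes> C)) (\<alpha>\<^sup>\<otimes> A B C)"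
    and assocT_natural: "\<lbrakk>f \<in> Hom A A'; g \<in> Hom B B'; h \<in> Hom C C'\<rbrakk>
        \<Longrightarrow> ((f \<otimes>\<^sub>m g) \<otimes>\<^sub>m h) \<Zsemi> \<alpha>\<^sup>\<otimes> A' B' C' = \<alpha>\<^sup>\<otimes> A B C \<Zsemi> (f \<otimes>\<^sub>m (g \<otimes>\<^sub>m h))"
    and lunitT_iso: "A \<in> Obj \<C> \<Longrightarrow> iso_arr \<C> (\<I> \<otimes> A) A (\<lambda>\<^sup>\<otimes> A)"
    and lunitT_natural: "f \<in> Hom A A' \<Longrightarrow> (\<one> \<I> \<otimes>\<^sub>m f) \<Zsemi> \<lambda>\<^sup>\<otimes> A' = \<lambda>\<^sup>\<otimes> A \<Zsemi> f"
    and runitT_iso: "A \<in> Obj \<C> \<Longrightarrow> iso_arr \<C> (A \<otimes> \<I>) A (\<rho>\<^sup>\<otimes> A)"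
    and runitT_natural: "f \<in> Hom A A' \<Longrightarrow> (f \<otimes>\<^sub>m \<one> \<I>) \<Zsemi> \<rho>\<^sup>\<otimes> A' = \<rho>\<^sup>\<otimes> A \<Zsemi> f"
    and pentagon: "\<lbrakk>A \<in> Obj \<C>; B \<in> Obj \<C>; C \<in> Obj \<C>; D \<in> Obj \<C>\<rbrakk>
        \<Longrightarrow> \<alpha>\<^sup>\<otimes> (A \<otimes> B) C D \<Zsemi> \<alpha>\<^sup>\<otimes> A B (C \<otimes> D)
          = (\<alpha>\<^sup>\<otimes> A B C \<otimes>\<^sub>m \<one> D) \<Zsemi> \<alpha>\<^sup>\<otimes> A (B \<otimes> C) D \<Zsemi> (\<one> A \<otimes>\<^sub>m \<alpha>\<^sup>\<otimes> B C D)"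
    and triangle: "\<lbrakk>A \<in> Obj \<C>; B \<in> Obj \<C>\<rbrakk>
        \<Longrightarrow> \<alpha>\<^sup>\<otimes> A \<I> B \<Zsemi> (\<one> A \<otimes>\<^sub>m \<lambda>\<^sup>\<otimes> B) = \<rho>\<^sup>\<otimes> A \<otimes>\<^sub>m \<one> B"

locale braided_monoidal_category = monoidal_category \<C>
  for \<C> :: "('o, 'm, 'x) bimonoidal_cat_scheme" (structure) +
  assumes braidT_iso: "\<lbrakk>A \<in> Obj \<C>; B \<in> Obj \<C>\<rbrakk> \<Longrightarrow> iso_arr \<C> (A \<otimes> B) (B \<otimes> A) (\<gamma>\<^sup>\<otimes> A B)"
    and braidT_natural: "\<lbrakk>f \<in> Hom A A'; g \<in> Hom B B'\<rbrakk>
        \<Longrightarrow> (f \<otimes>\<^sub>m g) \<Zsemi> \<gamma>\<^sup>\<otimes> A' B' = \<gamma>\<^sup>\<otimes> A B \<Zsemi> (g \<otimes>\<^sub>m f)"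
    and hexagon1: "\<lbrakk>A \<in> Obj \<C>; B \<in> Obj \<C>; C \<in> Obj \<C>\<rbrakk>
        \<Longrightarrow> \<alpha>\<^sup>\<otimes> A B C \<Zsemi> \<gamma>\<^sup>\<otimes> A (B \<otimes> C) \<Zsemi> \<alpha>\<^sup>\<otimes> B C A
          = (\<gamma>\<^sup>\<otimes> A B \<otimes>\<^sub>m \<one> C) \<Zsemi> \<alpha>\<^sup>\<otimes> B A C \<Zsemi> (\<one> B \<otimes>\<^sub>m \<gamma>\<^sup>\<otimes> A C)"
    and hexagon2: "\<lbrakk>A \<in> Obj \<C>; B \<in> Obj \<C>; C \<in> Obj \<C>\<rbrakk>
        \<Longrightarrow> (\<alpha>\<^sup>\<otimes> A B C)\<^sup>-\<^sup>1 \<Zsemi> \<gamma>\<^sup>\<otimes> (A \<otimes> B) C \<Zsemi> (\<alpha>\<^sup>\<otimes> C A B)\<^sup>-\<^sup>1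
          = (\<one> A \<otimes>\<^sub>m \<gamma>\<^sup>\<otimes> B C) \<Zsemi> (\<alpha>\<^sup>\<otimes> A C B)\<^sup>-\<^sup>1 \<Zsemi> (\<gamma>\<^sup>\<otimes> A C \<otimes>\<^sub>m \<one> B)"

text \<open>A bifunctor is additive in each argument if all its partial functors \<open>A \<otimes> -\<close> and
  \<open>- \<otimes> A\<close> are; these act on morphisms by tensoring with \<open>\<one> A\<close>.\<close>

locale additive_tensor =
  fixes \<C> :: "('o, 'm, 'x) bimonoidal_cat_scheme" (structure)
  assumes TensorM_Add_right: "\<lbrakk>A \<in> Obj \<C>; f \<in> Hom B C; g \<in> Hom B C\<rbrakk>
        \<Longrightarrow> \<one> A \<otimes>\<^sub>m (f \<boxplus> g) = (\<one> A \<otimes>\<^sub>m f) \<boxplus> (\<one> A \<otimes>\<^sub>m g)"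
    and TensorM_Add_left: "\<lbrakk>A \<in> Obj \<C>; f \<in> Hom B C; g \<in> Hom B C\<rbrakk>
        \<Longrightarrow> (f \<boxplus> g) \<otimes>\<^sub>m \<one> A = (f \<otimes>\<^sub>m \<one> A) \<boxplus> (g \<otimes>\<^sub>m \<one> A)"

definition distl :: "('o, 'm, 'x) bimonoidal_cat_scheme \<Rightarrow> 'o \<Rightarrow> 'o \<Rightarrow> 'o \<Rightarrow> 'm" (\<open>\<delta>\<index>\<close>) where
  "\<delta>\<^bsub>\<C>\<^esub> A B C =
     (THE h. h \<in> Hom\<^bsub>\<C>\<^esub> (A \<otimes>\<^bsub>\<C>\<^esub> (B \<oplus>\<^bsub>\<C>\<^esub> C)) (A \<otimes>\<^bsub>\<C>\<^esub> B \<oplus>\<^bsub>\<C>\<^esub> A \<otimes>\<^bsub>\<C>\<^esub> C) \<and>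
        h \<Zsemi>\<^bsub>\<C>\<^esub> p\<^sub>1\<^bsub>\<C>\<^esub> (A \<otimes>\<^bsub>\<C>\<^esub> B) (A \<otimes>\<^bsub>\<C>\<^esub> C) = \<one>\<^bsub>\<C>\<^esub> A \<otimes>\<^sub>m\<^bsub>\<C>\<^esub> p\<^sub>1\<^bsub>\<C>\<^esub> B C \<and>
        h \<Zsemi>\<^bsub>\<C>\<^esub> p\<^sub>2\<^bsub>\<C>\<^esub> (A \<otimes>\<^bsub>\<C>\<^esub> B) (A \<otimes>\<^bsub>\<C>\<^esub> C) = \<one>\<^bsub>\<C>\<^esub> A \<otimes>\<^sub>m\<^bsub>\<C>\<^esub> p\<^sub>2\<^bsub>\<C>\<^esub> B C)"

definition annih :: "('o, 'm, 'x) bimonoidal_cat_scheme \<Rightarrow> 'o \<Rightarrow> 'm" (\<open>\<epsilon>\<index>\<close>) where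
  "\<epsilon>\<^bsub>\<C>\<^esub> A = (THE h. h \<in> Hom\<^bsub>\<C>\<^esub> (A \<otimes>\<^bsub>\<C>\<^esub> \<zero>\<^bsub>\<C>\<^esub>) \<zero>\<^bsub>\<C>\<^esub>)"

definition double_braid :: "('o, 'm, 'x) bimonoidal_cat_scheme \<Rightarrow> 'o \<Rightarrow> 'o \<Rightarrow> 'm" (\<open>\<beta>\<index>\<close>) where
  "\<beta>\<^bsub>\<C>\<^esub> X Y = \<gamma>\<^sup>\<otimes>\<^bsub>\<C>\<^esub> X Y \<Zsemi>\<^bsub>\<C>\<^esub> \<gamma>\<^sup>\<otimes>\<^bsub>\<C>\<^esub> Y X"

text \<open>For \<open>P = AC\<close>, \<open>Q = AD\<close>, \<open>R = BC\<close>, \<open>S = BD\<close> the following isomorphism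
  \<open>(P \<oplus> Q) \<oplus> (R \<oplus> S) \<rightarrow> (P \<oplus> R) \<oplus> (Q \<oplus> S)\<close> interchanges the two middle summands.\<close>

definition interchange :: "('o, 'm, 'x) bimonoidal_cat_scheme \<Rightarrow> 'o \<Rightarrow> 'o \<Rightarrow> 'o \<Rightarrow> 'o \<Rightarrow> 'm" (\<open>\<sigma>\<index>\<close>) where
  "\<sigma>\<^bsub>\<C>\<^esub> A B C D =
     (let P = A \<otimes>\<^bsub>\<C>\<^esub> C; Q = A \<otimes>\<^bsub>\<C>\<^esub> D; R = B \<otimes>\<^bsub>\<C>\<^esub> C; S = B \<otimes>\<^bsub>\<C>\<^esub> D in
        (\<alpha>\<^sup>\<oplus>\<^bsub>\<C>\<^esub> (P \<oplus>\<^bsub>\<C>\<^esub> Q) R S)\<^sup>-\<^sup>1\<^bsub>\<C>\<^esub>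
        \<Zsemi>\<^bsub>\<C>\<^esub> (\<alpha>\<^sup>\<oplus>\<^bsub>\<C>\<^esub> P Q R \<oplus>\<^sub>m\<^bsub>\<C>\<^esub> \<one>\<^bsub>\<C>\<^esub> S)
        \<Zsemi>\<^bsub>\<C>\<^esub> ((\<one>\<^bsub>\<C>\<^esub> P \<oplus>\<^sub>m\<^bsub>\<C>\<^esub> \<gamma>\<^sup>\<oplus>\<^bsub>\<C>\<^esub> R Q) \<oplus>\<^sub>m\<^bsub>\<C>\<^esub> \<one>\<^bsub>\<C>\<^esub> S)\<^sup>-\<^sup>1\<^bsub>\<C>\<^esub>
        \<Zsemi>\<^bsub>\<C>\<^esub> (\<alpha>\<^sup>\<oplus>\<^bsub>\<C>\<^esub> P R Q \<oplus>\<^sub>m\<^bsub>\<C>\<^esub> \<one>\<^bsub>\<C>\<^esub> S)\<^sup>-\<^sup>1\<^bsub>\<C>\<^esub>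
        \<Zsemi>\<^bsub>\<C>\<^esub> \<alpha>\<^sup>\<oplus>\<^bsub>\<C>\<^esub> (P \<oplus>\<^bsub>\<C>\<^esub> R) Q S)"

end

theory Submission
  imports Defs
begin

text \<open>
  Morphisms into a biproduct are determined by their components, and morphisms into a zero object
  are unique. Composed with the projections, the two sides of an axiom between biproducts become the
  same composite of projections and tensor products of projections, by naturality of the monoidal
  structure. The remaining new axioms compare morphisms into a zero object, apart from (12), which
  is a first component, and (7), which is the inverse of a hexagon; \<open>A \<otimes> \<zero>\<close> is a zero object
  because additivity of \<open>A \<otimes> -\<close> makes its identity the zero morphism.
\<close>

text \<open>Composition laws hold only for composable arrows, so every rewrite is conditional, and
  much of the work lies in discharging typing premises. Typing is therefore kept as membership in
  \<open>Arr\<close> with equations for \<open>Dom\<close> and \<open>Cod\<close>, which the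
  simplifier proves by itself, while membership in \<open>Hom\<close> would make it guess objects.
  Composites are normalised to nest to the right; a rule for two adjacent factors then needs a
  companion with an arbitrary factor behind them. Inverses are a further obstacle: they are definite
  descriptions, to which the projection rules do not apply, so the inverse of a sum is replaced by
  the sum of the inverses. As the braiding need not be symmetric, each inverse braiding has to meet
  exactly its own braiding; naturality achieves this by carrying the projections out from between
  the two.\<close>

context category
begin

lemma in_Hom_iff: "f \<in> Hom A B \<longleftrightarrow> f \<in> Arr \<C> \<and> Dom \<C> f = A \<and> Cod \<C> f = B"
  by (simp add: Hom_def)

lemmas Dom_Obj [simp] Cod_Obj [simp]

lemma Hom_Obj: "f \<in> Hom A B \<Longrightarrow> A \<in> Obj \<C> \<and> B \<in> Obj \<C>"
  by (auto simp: in_Hom_iff)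

lemma Ident_typing [simp]:
  assumes "A \<in> Obj \<C>"
  shows "\<one> A \<in> Arr \<C>" "Dom \<C> (\<one> A) = A" "Cod \<C> (\<one> A) = A"
  using Ident_Hom[OF assms] by (auto simp: in_Hom_iff)

lemma Comp_typing [simp]:
  assumes "f \<in> Arr \<C>" "g \<in> Arr \<C>" "Cod \<C> f = Dom \<C> g"
  shows "f \<Zsemi> g \<in> Arr \<C>" "Dom \<C> (f \<Zsemi> g) = Dom \<C> f" "Cod \<C> (f \<Zsemi> g) = Cod \<C> g"
  using Comp_Hom[of f "Dom \<C> f" "Cod \<C> f" g "Cod \<C> g"] assms by (auto simp: in_Hom_iff)

lemma Ident_left [simp]: "\<lbrakk>f \<in> Arr \<C>; Dom \<C> f = A\<rbrakk> \<Longrightarrow> \<one> A \<Zsemi> f = f"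
  using Ident_Comp[of f "Dom \<C> f" "Cod \<C> f"] by (auto simp: in_Hom_iff)

lemma Ident_right [simp]: "\<lbrakk>f \<in> Arr \<C>; Cod \<C> f = B\<rbrakk> \<Longrightarrow> f \<Zsemi> \<one> B = f"
  using Comp_Ident[of f "Dom \<C> f" "Cod \<C> f"] by (auto simp: in_Hom_iff)

lemma Comp_reassoc [simp]:
  assumes "f \<in> Arr \<C>" "g \<in> Arr \<C>" "h \<in> Arr \<C>" "Cod \<C> f = Dom \<C> g" "Cod \<C> g = Dom \<C> h"
  shows "(f \<Zsemi> g) \<Zsemi> h = f \<Zsemi> (g \<Zsemi> h)"
  using Comp_assoc[of f "Dom \<C> f" "Cod \<C> f" g "Cod \<C> g" h "Cod \<C> h"] assms
  by (auto simp: in_Hom_iff)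

text \<open>Turns a rewrite rule for \<open>f \<Zsemi> g\<close> into one that applies inside a right-nested composite.\<close>

lemma Comp_extend:
  assumes "f \<Zsemi> g = h" "f \<in> Arr \<C>" "g \<in> Arr \<C>" "Cod \<C> f = Dom \<C> g"
    and "k \<in> Arr \<C>" "Dom \<C> k = Cod \<C> g"
  shows "f \<Zsemi> (g \<Zsemi> k) = h \<Zsemi> k"
  using assms by (metis Comp_reassoc)

text \<open>Any other inverse \<open>h\<close> satisfies \<open>h = h \<Zsemi> (f \<Zsemi> g) = (h
  \<Zsemi> f) \<Zsemi> g = g\<close>, which gives the definite description its value. Closed
  formulas for inverses come from exhibiting such a \<open>g\<close>.\<close>

lemma inverse_unique:
  assumes "f \<in> Hom A B" "g \<in> Hom B A" "f \<Zsemi> g = \<one> A" "g \<Zsemi> f = \<one> B"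
  shows "f\<^sup>-\<^sup>1 = g"
  unfolding inverse_arr_def
proof (rule the_equality)
  show "g \<in> Hom (Cod \<C> f) (Dom \<C> f) \<and> f \<Zsemi> g = \<one> (Dom \<C> f) \<and> g \<Zsemi> f = \<one> (Cod \<C> f)"
    using assms by (simp add: in_Hom_iff)
next
  fix h assume h: "h \<in> Hom (Cod \<C> f) (Dom \<C> f) \<and> f \<Zsemi> h = \<one> (Dom \<C> f) \<and> h \<Zsemi> f = \<one> (Cod \<C> f)"
  have "h = h \<Zsemi> (f \<Zsemi> g)" using assms h by (simp add: in_Hom_iff)
  also have "\<dots> = (h \<Zsemi> f) \<Zsemi> g"
    by (rule Comp_reassoc[symmetric]) (use assms(1,2) h in \<open>simp_all add: in_Hom_iff\<close>)
  also have "\<dots> = g" using assms(1,2) h by (simp add: in_Hom_iff)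
  finally show "h = g" .
qed

lemma iso_inverse:
  assumes "iso_arr \<C> A B f"
  shows "f \<in> Arr \<C>" "Dom \<C> f = A" "Cod \<C> f = B"
    and "f\<^sup>-\<^sup>1 \<in> Arr \<C>" "Dom \<C> (f\<^sup>-\<^sup>1) = B" "Cod \<C> (f\<^sup>-\<^sup>1) = A"
    and "f \<Zsemi> f\<^sup>-\<^sup>1 = \<one> A" "f\<^sup>-\<^sup>1 \<Zsemi> f = \<one> B"
proof -
  obtain g where g: "f \<in> Hom A B" "g \<in> Hom B A" "f \<Zsemi> g = \<one> A" "g \<Zsemi> f = \<one> B"
    using assms by (auto simp: iso_arr_def)
  then show "f \<in> Arr \<C>" "Dom \<C> f = A" "Cod \<C> f = B"
    "f\<^sup>-\<^sup>1 \<in> Arr \<C>" "Dom \<C> (f\<^sup>-\<^sup>1) = B" "Cod \<C> (f\<^sup>-\<^sup>1) = A"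
    "f \<Zsemi> f\<^sup>-\<^sup>1 = \<one> A" "f\<^sup>-\<^sup>1 \<Zsemi> f = \<one> B"
    by (simp_all add: inverse_unique[OF g] in_Hom_iff)
qed

lemma iso_inverse_extend:
  assumes "iso_arr \<C> A B f"
  shows "\<lbrakk>k \<in> Arr \<C>; Dom \<C> k = A\<rbrakk> \<Longrightarrow> f \<Zsemi> (f\<^sup>-\<^sup>1 \<Zsemi> k) = k"
    and "\<lbrakk>k \<in> Arr \<C>; Dom \<C> k = B\<rbrakk> \<Longrightarrow> f\<^sup>-\<^sup>1 \<Zsemi> (f \<Zsemi> k) = k"
proof -
  note ty = iso_inverse(1-6)[OF assms]
  show "f \<Zsemi> (f\<^sup>-\<^sup>1 \<Zsemi> k) = k" if "k \<in> Arr \<C>" "Dom \<C> k = A"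
    using Comp_extend[OF iso_inverse(7)[OF assms], of k] ty that by simp
  show "f\<^sup>-\<^sup>1 \<Zsemi> (f \<Zsemi> k) = k" if "k \<in> Arr \<C>" "Dom \<C> k = B"
    using Comp_extend[OF iso_inverse(8)[OF assms], of k] ty that by simp
qed

lemma iso_arrI:
  assumes "f \<in> Hom A B" "g \<in> Hom B A" "f \<Zsemi> g = \<one> A" "g \<Zsemi> f = \<one> B"
  shows "iso_arr \<C> A B f"
  unfolding iso_arr_def using assms by blast

lemma iso_arr_inverse:
  assumes "iso_arr \<C> A B f"
  shows "iso_arr \<C> B A (f\<^sup>-\<^sup>1)"
  by (rule iso_arrI[of _ _ _ f]) (use iso_inverse[OF assms] in \<open>simp_all add: in_Hom_iff\<close>)

lemma inverse_inverse:
  assumes "iso_arr \<C> A B f"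
  shows "(f\<^sup>-\<^sup>1)\<^sup>-\<^sup>1 = f"
  by (rule inverse_unique[of _ B A]) (use iso_inverse[OF assms] in \<open>simp_all add: in_Hom_iff\<close>)

lemma iso_arr_Ident: "A \<in> Obj \<C> \<Longrightarrow> iso_arr \<C> A A (\<one> A)"
  by (rule iso_arrI[of _ _ _ "\<one> A"]) (simp_all add: in_Hom_iff)

lemma inverse_Ident [simp]: "A \<in> Obj \<C> \<Longrightarrow> (\<one> A)\<^sup>-\<^sup>1 = \<one> A"
  by (rule inverse_unique[of _ A A]) (simp_all add: in_Hom_iff)

lemma
  assumes f: "iso_arr \<C> A B f" and g: "iso_arr \<C> B C g"
  shows iso_arr_Comp: "iso_arr \<C> A C (f \<Zsemi> g)"
    and inverse_Comp: "(f \<Zsemi> g)\<^sup>-\<^sup>1 = g\<^sup>-\<^sup>1 \<Zsemi> f\<^sup>-\<^sup>1"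
proof -
  note typing = iso_inverse[OF f] iso_inverse[OF g] iso_inverse_extend[OF f] iso_inverse_extend[OF g]
  have inv: "f \<Zsemi> g \<in> Hom A C" "g\<^sup>-\<^sup>1 \<Zsemi> f\<^sup>-\<^sup>1 \<in> Hom C A"
    "(f \<Zsemi> g) \<Zsemi> (g\<^sup>-\<^sup>1 \<Zsemi> f\<^sup>-\<^sup>1) = \<one> A" "(g\<^sup>-\<^sup>1 \<Zsemi> f\<^sup>-\<^sup>1) \<Zsemi> (f \<Zsemi> g) = \<one> C"
    using typing by (simp_all add: in_Hom_iff)
  from inv show "iso_arr \<C> A C (f \<Zsemi> g)" by (rule iso_arrI)
  from inv show "(f \<Zsemi> g)\<^sup>-\<^sup>1 = g\<^sup>-\<^sup>1 \<Zsemi> f\<^sup>-\<^sup>1" by (rule inverse_unique)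
qed

text \<open>Stated with \<open>Dom\<close> and \<open>Cod\<close>, so that an equation between
  morphisms into a zero object leaves only typing goals.\<close>

lemma zero_object_into_unique:
  assumes "zero_object \<C> Z" "f \<in> Arr \<C>" "g \<in> Arr \<C>"
    and "Dom \<C> f = Dom \<C> g" "Cod \<C> f = Z" "Cod \<C> g = Z"
  shows "f = g"
proof -
  have "\<exists>!h. h \<in> Hom (Dom \<C> f) Z" using assms unfolding zero_object_def by simp
  then show ?thesis using assms by (auto simp: in_Hom_iff)
qed

end

section \<open>Zero morphisms, zero objects and biproducts in a preadditive category\<close>

context preadditive_category
begin

lemma ZeroM_typing [simp]:
  assumes "A \<in> Obj \<C>" "B \<in> Obj \<C>"
  shows "ZeroM \<C> A B \<in> Arr \<C>" "Dom \<C> (ZeroM \<C> A B) = A" "Cod \<C> (ZeroM \<C> A B) = B"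
proof -
  interpret G: comm_group "hom_group \<C> A B" by (rule hom_comm_group[OF assms])
  have "ZeroM \<C> A B \<in> Hom A B" using G.one_closed by (simp add: hom_group_def)
  then show "ZeroM \<C> A B \<in> Arr \<C>" "Dom \<C> (ZeroM \<C> A B) = A" "Cod \<C> (ZeroM \<C> A B) = B"
    by (simp_all add: in_Hom_iff)
qed

lemma Add_typing [simp]:
  assumes "f \<in> Arr \<C>" "g \<in> Arr \<C>" "Dom \<C> f = Dom \<C> g" "Cod \<C> f = Cod \<C> g"
  shows "f \<boxplus> g \<in> Arr \<C>" "Dom \<C> (f \<boxplus> g) = Dom \<C> g" "Cod \<C> (f \<boxplus> g) = Cod \<C> g"
proof -
  interpret G: comm_group "hom_group \<C> (Dom \<C> g) (Cod \<C> g)"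
    using assms by (simp add: hom_comm_group)
  have "f \<boxplus> g \<in> Hom (Dom \<C> g) (Cod \<C> g)"
    using G.m_closed[of f g] assms by (simp add: hom_group_def in_Hom_iff)
  then show "f \<boxplus> g \<in> Arr \<C>" "Dom \<C> (f \<boxplus> g) = Dom \<C> g" "Cod \<C> (f \<boxplus> g) = Cod \<C> g"
    by (simp_all add: in_Hom_iff)
qed

lemma Add_ZeroM [simp]:
  assumes "f \<in> Arr \<C>" "Dom \<C> f = A" "Cod \<C> f = B"
  shows "f \<boxplus> ZeroM \<C> A B = f" "ZeroM \<C> A B \<boxplus> f = f"
proof -
  interpret G: comm_group "hom_group \<C> A B" using assms by (auto intro: hom_comm_group)
  show "f \<boxplus> ZeroM \<C> A B = f" "ZeroM \<C> A B \<boxplus> f = f"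
    using G.r_one[of f] G.l_one[of f] assms by (simp_all add: hom_group_def in_Hom_iff)
qed

text \<open>Cancellation in the hom group. Used with \<open>g = f\<close>, it recognises a zero
  morphism by \<open>f \<boxplus> f = f\<close>, a property that additive operations
  preserve.\<close>

lemma Add_absorb_imp_ZeroM:
  assumes "f \<in> Hom A B" "g \<in> Hom A B" "f \<boxplus> g = f"
  shows "g = ZeroM \<C> A B"
proof -
  interpret G: comm_group "hom_group \<C> A B"
    using Hom_Obj[OF assms(1)] by (simp add: hom_comm_group)
  show ?thesis
    using G.r_cancel_one'[of f g] G.l_cancel_one[of f g] assms by (simp add: hom_group_def)
qed

text \<open>Bilinearity has to yield this: the zero morphism is its own double, so the composite is
  its own double as well.\<close>

lemma Comp_ZeroM [simp]:
  assumes "f \<in> Arr \<C>" "Cod \<C> f = B" "C \<in> Obj \<C>"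
  shows "f \<Zsemi> ZeroM \<C> B C = ZeroM \<C> (Dom \<C> f) C"
proof (rule Add_absorb_imp_ZeroM)
  have B: "B \<in> Obj \<C>" using assms by auto
  show hom: "f \<Zsemi> ZeroM \<C> B C \<in> Hom (Dom \<C> f) C" using assms B by (simp add: in_Hom_iff)
  show "f \<Zsemi> ZeroM \<C> B C \<in> Hom (Dom \<C> f) C" by (rule hom)
  show "(f \<Zsemi> ZeroM \<C> B C) \<boxplus> (f \<Zsemi> ZeroM \<C> B C) = f \<Zsemi> ZeroM \<C> B C"
    using Comp_Add[of f "Dom \<C> f" B "ZeroM \<C> B C" C "ZeroM \<C> B C"] assms B
    by (simp add: in_Hom_iff)
qed

lemma ZeroM_Comp [simp]:
  assumes "f \<in> Arr \<C>" "Dom \<C> f = B" "A \<in> Obj \<C>"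
  shows "ZeroM \<C> A B \<Zsemi> f = ZeroM \<C> A (Cod \<C> f)"
proof (rule Add_absorb_imp_ZeroM)
  have B: "B \<in> Obj \<C>" using assms by auto
  show hom: "ZeroM \<C> A B \<Zsemi> f \<in> Hom A (Cod \<C> f)" using assms B by (simp add: in_Hom_iff)
  show "ZeroM \<C> A B \<Zsemi> f \<in> Hom A (Cod \<C> f)" by (rule hom)
  show "(ZeroM \<C> A B \<Zsemi> f) \<boxplus> (ZeroM \<C> A B \<Zsemi> f) = ZeroM \<C> A B \<Zsemi> f"
    using Add_Comp[of "ZeroM \<C> A B" A B "ZeroM \<C> A B" f "Cod \<C> f"] assms B
    by (simp add: in_Hom_iff)
qed

text \<open>Every \<open>f\<close> out of \<open>Z\<close> equals
  \<open>\<one> Z \<Zsemi> f\<close>, hence is a zero morphism; dually for morphisms into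
  \<open>Z\<close>.\<close>

lemma zero_objectI:
  assumes "Z \<in> Obj \<C>" "\<one> Z = ZeroM \<C> Z Z"
  shows "zero_object \<C> Z"
proof -
  have "f = ZeroM \<C> Z A" if "f \<in> Hom Z A" for f A
    using that assms Ident_Comp[OF that] by (auto simp: in_Hom_iff)
  moreover have "f = ZeroM \<C> A Z" if "f \<in> Hom A Z" for f A
    using that assms Comp_Ident[OF that] by (auto simp: in_Hom_iff)
  moreover have "ZeroM \<C> Z A \<in> Hom Z A" "ZeroM \<C> A Z \<in> Hom A Z" if "A \<in> Obj \<C>" for A
    using that assms(1) by (simp_all add: in_Hom_iff)
  ultimately show ?thesis
    using assms(1) unfolding zero_object_def by blast
qed

text \<open>Expanding \<open>i1 = i1 \<Zsemi> \<one> S\<close> by the sum formula for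
  \<open>\<one> S\<close> gives \<open>i1 = i1 \<boxplus> (i1 \<Zsemi> p2 \<Zsemi> i2)\<close>. The
  second summand is therefore zero, and composing it with \<open>p2\<close> removes
  \<open>i2\<close>.\<close>

lemma is_biproduct_In_Pr_zero:
  assumes "is_biproduct \<C> A B S p1 p2 i1 i2"
  shows "i1 \<Zsemi> p2 = ZeroM \<C> A B" "i2 \<Zsemi> p1 = ZeroM \<C> B A"
proof -
  have bp: "p1 \<in> Hom S A" "p2 \<in> Hom S B" "i1 \<in> Hom A S" "i2 \<in> Hom B S"
    "i1 \<Zsemi> p1 = \<one> A" "i2 \<Zsemi> p2 = \<one> B" "(p1 \<Zsemi> i1) \<boxplus> (p2 \<Zsemi> i2) = \<one> S"
    using assms by (auto simp: is_biproduct_def)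
  note ty = bp(1-4)[unfolded in_Hom_iff]
  have obj: "A \<in> Obj \<C>" "B \<in> Obj \<C>" "S \<in> Obj \<C>" using bp Hom_Obj by blast+
  have "(i1 \<Zsemi> (p1 \<Zsemi> i1)) \<boxplus> (i1 \<Zsemi> (p2 \<Zsemi> i2)) = i1 \<Zsemi> ((p1 \<Zsemi> i1) \<boxplus> (p2 \<Zsemi> i2))"
    by (rule Comp_Add[symmetric, of _ A S _ S]) (use ty in \<open>simp_all add: in_Hom_iff\<close>)
  moreover have "i1 \<Zsemi> (p1 \<Zsemi> i1) = i1" using ty Comp_extend[OF bp(5)] by simp
  ultimately have "i1 \<boxplus> (i1 \<Zsemi> (p2 \<Zsemi> i2)) = i1" using ty bp(7) by simp
  then have "i1 \<Zsemi> (p2 \<Zsemi> i2) = ZeroM \<C> A S"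
    using ty by (intro Add_absorb_imp_ZeroM[of i1]) (simp_all add: in_Hom_iff)
  then have "(i1 \<Zsemi> (p2 \<Zsemi> i2)) \<Zsemi> p2 = ZeroM \<C> A S \<Zsemi> p2" by simp
  then show "i1 \<Zsemi> p2 = ZeroM \<C> A B" using ty bp(6) obj by simp
  have "(i2 \<Zsemi> (p1 \<Zsemi> i1)) \<boxplus> (i2 \<Zsemi> (p2 \<Zsemi> i2)) = i2 \<Zsemi> ((p1 \<Zsemi> i1) \<boxplus> (p2 \<Zsemi> i2))"
    by (rule Comp_Add[symmetric, of _ B S _ S]) (use ty in \<open>simp_all add: in_Hom_iff\<close>)
  moreover have "i2 \<Zsemi> (p2 \<Zsemi> i2) = i2" using ty Comp_extend[OF bp(6)] by simp
  ultimately have *: "(i2 \<Zsemi> (p1 \<Zsemi> i1)) \<boxplus> i2 = i2" using ty bp(7) by simp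
  \<comment> \<open>Here \<open>i2\<close> is the right summand, while the absorption rule expects
    it on the left, so commutativity is needed.\<close>
  interpret G: comm_group "hom_group \<C> B S" using obj by (simp add: hom_comm_group)
  have "i2 \<boxplus> (i2 \<Zsemi> (p1 \<Zsemi> i1)) = i2"
    using * G.m_comm[of i2 "i2 \<Zsemi> (p1 \<Zsemi> i1)"] ty by (simp add: hom_group_def in_Hom_iff)
  then have "i2 \<Zsemi> (p1 \<Zsemi> i1) = ZeroM \<C> B S"
    using ty by (intro Add_absorb_imp_ZeroM[of i2]) (simp_all add: in_Hom_iff)
  then have "(i2 \<Zsemi> (p1 \<Zsemi> i1)) \<Zsemi> p1 = ZeroM \<C> B S \<Zsemi> p1" by simp
  then show "i2 \<Zsemi> p1 = ZeroM \<C> B A" using ty bp(5) obj by simp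
qed

text \<open>The pair is \<open>(f \<Zsemi> i1) \<boxplus> (g \<Zsemi> i2)\<close>; the cross terms
  vanish because the mixed composites of injections and projections do. Uniqueness follows by
  composing \<open>h\<close> with the sum formula for \<open>\<one> S\<close>.\<close>

lemma is_biproduct_pairing:
  assumes bp: "is_biproduct \<C> A B S p1 p2 i1 i2" and f: "f \<in> Hom X A" and g: "g \<in> Hom X B"
  shows "\<exists>!h. h \<in> Hom X S \<and> h \<Zsemi> p1 = f \<and> h \<Zsemi> p2 = g"
proof -
  have bp': "p1 \<in> Hom S A" "p2 \<in> Hom S B" "i1 \<in> Hom A S" "i2 \<in> Hom B S"
    "i1 \<Zsemi> p1 = \<one> A" "i2 \<Zsemi> p2 = \<one> B" "(p1 \<Zsemi> i1) \<boxplus> (p2 \<Zsemi> i2) = \<one> S"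
    using bp by (auto simp: is_biproduct_def)
  note ty = bp'(1-4)[unfolded in_Hom_iff] f[unfolded in_Hom_iff] g[unfolded in_Hom_iff]
  have obj: "A \<in> Obj \<C>" "B \<in> Obj \<C>" "S \<in> Obj \<C>" "X \<in> Obj \<C>" using bp' f Hom_Obj by blast+
  let ?h = "(f \<Zsemi> i1) \<boxplus> (g \<Zsemi> i2)"
  have "?h \<Zsemi> p1 = ((f \<Zsemi> i1) \<Zsemi> p1) \<boxplus> ((g \<Zsemi> i2) \<Zsemi> p1)"
    by (rule Add_Comp[of _ X S _ _ A]) (use ty in \<open>simp_all add: in_Hom_iff\<close>)
  then have h1: "?h \<Zsemi> p1 = f"
    using ty obj bp'(5) is_biproduct_In_Pr_zero[OF bp] by simp
  have "?h \<Zsemi> p2 = ((f \<Zsemi> i1) \<Zsemi> p2) \<boxplus> ((g \<Zsemi> i2) \<Zsemi> p2)"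
    by (rule Add_Comp[of _ X S _ _ B]) (use ty in \<open>simp_all add: in_Hom_iff\<close>)
  then have h2: "?h \<Zsemi> p2 = g"
    using ty obj bp'(6) is_biproduct_In_Pr_zero[OF bp] by simp
  show ?thesis
  proof (rule ex1I[of _ ?h])
    show "?h \<in> Hom X S \<and> ?h \<Zsemi> p1 = f \<and> ?h \<Zsemi> p2 = g"
      using h1 h2 ty by (simp add: in_Hom_iff)
  next
    fix h assume "h \<in> Hom X S \<and> h \<Zsemi> p1 = f \<and> h \<Zsemi> p2 = g"
    then have h: "h \<in> Hom X S" "h \<Zsemi> p1 = f" "h \<Zsemi> p2 = g" by auto
    have "h = h \<Zsemi> ((p1 \<Zsemi> i1) \<boxplus> (p2 \<Zsemi> i2))" using h(1) bp'(7) by (simp add: in_Hom_iff)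
    also have "\<dots> = (h \<Zsemi> (p1 \<Zsemi> i1)) \<boxplus> (h \<Zsemi> (p2 \<Zsemi> i2))"
      by (rule Comp_Add[of _ X S _ S]) (use ty h(1) in \<open>simp_all add: in_Hom_iff\<close>)
    also have "\<dots> = ?h" using ty h(1) Comp_extend[OF h(2)] Comp_extend[OF h(3)] by (simp add: in_Hom_iff)
    finally show "h = ?h" .
  qed
qed

end

section \<open>Chosen biproducts: sums of morphisms, symmetry and associativity\<close>

locale biproduct_category = preadditive_category \<C> + chosen_biproducts \<C>
  for \<C> :: "('o, 'm, 'x) biprod_cat_scheme" (structure)
begin

lemma ZeroO_Obj [simp]: "\<zero> \<in> Obj \<C>"
  using zero_object_ZeroO by (simp add: zero_object_def)

lemma SumO_Obj [simp]: "\<lbrakk>A \<in> Obj \<C>; B \<in> Obj \<C>\<rbrakk> \<Longrightarrow> A \<oplus> B \<in> Obj \<C>"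
  using is_biproduct_SumO by (simp add: is_biproduct_def)

lemma Pr_typing [simp]:
  assumes "A \<in> Obj \<C>" "B \<in> Obj \<C>"
  shows "p\<^sub>1 A B \<in> Arr \<C>" "Dom \<C> (p\<^sub>1 A B) = A \<oplus> B" "Cod \<C> (p\<^sub>1 A B) = A"
    and "p\<^sub>2 A B \<in> Arr \<C>" "Dom \<C> (p\<^sub>2 A B) = A \<oplus> B" "Cod \<C> (p\<^sub>2 A B) = B"
  using is_biproduct_SumO[OF assms] by (auto simp: is_biproduct_def in_Hom_iff)

text \<open>This is what \<open>theI'\<close> asks for in the definite descriptions of
  \<open>SumM\<close>, \<open>symS\<close> and \<open>distl\<close>.\<close>

lemma ex1_pairing:
  assumes "f \<in> Arr \<C>" "g \<in> Arr \<C>" "Dom \<C> f = X" "Dom \<C> g = X" "Cod \<C> f = A" "Cod \<C> g = B"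
  shows "\<exists>!h. h \<in> Hom X (A \<oplus> B) \<and> h \<Zsemi> p\<^sub>1 A B = f \<and> h \<Zsemi> p\<^sub>2 A B = g"
  using assms by (intro is_biproduct_pairing[OF is_biproduct_SumO]) (auto simp: in_Hom_iff)

lemma Pr_jointly_monic:
  assumes "A \<in> Obj \<C>" "B \<in> Obj \<C>" "h \<in> Arr \<C>" "k \<in> Arr \<C>"
    and "Dom \<C> h = Dom \<C> k" "Cod \<C> h = A \<oplus> B" "Cod \<C> k = A \<oplus> B"
    and "h \<Zsemi> p\<^sub>1 A B = k \<Zsemi> p\<^sub>1 A B" "h \<Zsemi> p\<^sub>2 A B = k \<Zsemi> p\<^sub>2 A B"
  shows "h = k"
  using ex1_pairing[of "k \<Zsemi> p\<^sub>1 A B" "k \<Zsemi> p\<^sub>2 A B" "Dom \<C> k" A B] assms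
  by (auto simp: in_Hom_iff)

text \<open>Composition associates to the left, so the last two equations are literally the
  components of \<open>h \<Zsemi> p\<^sub>2 A (B \<oplus> C)\<close> and its counterpart for
  \<open>k\<close>. Joint monicity applies there and once more at the outer biproduct.\<close>

lemma Pr_jointly_monic_nested:
  assumes obj: "A \<in> Obj \<C>" "B \<in> Obj \<C>" "C \<in> Obj \<C>"
    and ty: "h \<in> Arr \<C>" "k \<in> Arr \<C>" "Dom \<C> h = Dom \<C> k"
      "Cod \<C> h = A \<oplus> (B \<oplus> C)" "Cod \<C> k = A \<oplus> (B \<oplus> C)"
    and eq: "h \<Zsemi> p\<^sub>1 A (B \<oplus> C) = k \<Zsemi> p\<^sub>1 A (B \<oplus> C)"
      "h \<Zsemi> p\<^sub>2 A (B \<oplus> C) \<Zsemi> p\<^sub>1 B C = k \<Zsemi> p\<^sub>2 A (B \<oplus> C) \<Zsemi> p\<^sub>1 B C"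
      "h \<Zsemi> p\<^sub>2 A (B \<oplus> C) \<Zsemi> p\<^sub>2 B C = k \<Zsemi> p\<^sub>2 A (B \<oplus> C) \<Zsemi> p\<^sub>2 B C"
  shows "h = k"
proof -
  have "h \<Zsemi> p\<^sub>2 A (B \<oplus> C) = k \<Zsemi> p\<^sub>2 A (B \<oplus> C)"
    by (rule Pr_jointly_monic[OF _ _ _ _ _ _ _ eq(2,3)]) (use obj ty in simp_all)
  with eq(1) show ?thesis
    \<comment> \<open>The rotation puts the two component equations in front of the seven typing
      premises, where the chained facts are matched.\<close>
    by (rule Pr_jointly_monic[rotated 7]) (use obj ty in simp_all)
qed

lemma SumM_props:
  assumes "f \<in> Arr \<C>" "g \<in> Arr \<C>"
  defines "A \<equiv> Dom \<C> f" and "B \<equiv> Dom \<C> g" and "A' \<equiv> Cod \<C> f" and "B' \<equiv> Cod \<C> g"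
  shows "f \<oplus>\<^sub>m g \<in> Hom (A \<oplus> B) (A' \<oplus> B') \<and>
    (f \<oplus>\<^sub>m g) \<Zsemi> p\<^sub>1 A' B' = p\<^sub>1 A B \<Zsemi> f \<and> (f \<oplus>\<^sub>m g) \<Zsemi> p\<^sub>2 A' B' = p\<^sub>2 A B \<Zsemi> g"
  unfolding SumM_def Let_def assms(3-6)
  by (rule theI', rule ex1_pairing) (use assms(1,2) in simp_all)

lemma SumM_typing [simp]:
  assumes "f \<in> Arr \<C>" "g \<in> Arr \<C>"
  shows "f \<oplus>\<^sub>m g \<in> Arr \<C>" "Dom \<C> (f \<oplus>\<^sub>m g) = Dom \<C> f \<oplus> Dom \<C> g"
    "Cod \<C> (f \<oplus>\<^sub>m g) = Cod \<C> f \<oplus> Cod \<C> g"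
  using SumM_props[OF assms] by (auto simp: in_Hom_iff)

text \<open>The codomains enter through premises: a goal shows them as already simplified objects,
  not as terms \<open>Cod \<C> f\<close>.\<close>

lemma SumM_Pr [simp]:
  assumes "f \<in> Arr \<C>" "g \<in> Arr \<C>" "Cod \<C> f = A'" "Cod \<C> g = B'"
  shows "(f \<oplus>\<^sub>m g) \<Zsemi> p\<^sub>1 A' B' = p\<^sub>1 (Dom \<C> f) (Dom \<C> g) \<Zsemi> f"
    and "(f \<oplus>\<^sub>m g) \<Zsemi> p\<^sub>2 A' B' = p\<^sub>2 (Dom \<C> f) (Dom \<C> g) \<Zsemi> g"
  using SumM_props[OF assms(1,2)] assms(3,4) by auto

text \<open>The companion for composites that continue after the projection. The other lemmas with
  suffix \<open>_extend\<close> likewise serve right-nested composites.\<close>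

lemma SumM_Pr_extend [simp]:
  assumes "f \<in> Arr \<C>" "g \<in> Arr \<C>" "Cod \<C> f = A'" "Cod \<C> g = B'" "k \<in> Arr \<C>"
  shows "Dom \<C> k = A' \<Longrightarrow> (f \<oplus>\<^sub>m g) \<Zsemi> (p\<^sub>1 A' B' \<Zsemi> k) = p\<^sub>1 (Dom \<C> f) (Dom \<C> g) \<Zsemi> (f \<Zsemi> k)"
    and "Dom \<C> k = B' \<Longrightarrow> (f \<oplus>\<^sub>m g) \<Zsemi> (p\<^sub>2 A' B' \<Zsemi> k) = p\<^sub>2 (Dom \<C> f) (Dom \<C> g) \<Zsemi> (g \<Zsemi> k)"
  using assms Comp_extend[OF SumM_Pr(1)[OF assms(1-4)], of k]
    Comp_extend[OF SumM_Pr(2)[OF assms(1-4)], of k] by auto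

lemma
  assumes f: "iso_arr \<C> A A' f" and g: "iso_arr \<C> B B' g"
  shows iso_arr_SumM: "iso_arr \<C> (A \<oplus> B) (A' \<oplus> B') (f \<oplus>\<^sub>m g)"
    and inverse_SumM: "(f \<oplus>\<^sub>m g)\<^sup>-\<^sup>1 = f\<^sup>-\<^sup>1 \<oplus>\<^sub>m g\<^sup>-\<^sup>1"
proof -
  note ty = iso_inverse[OF f] iso_inverse[OF g]
  have obj: "A \<in> Obj \<C>" "A' \<in> Obj \<C>" "B \<in> Obj \<C>" "B' \<in> Obj \<C>" using ty by auto
  have 1: "(f \<oplus>\<^sub>m g) \<Zsemi> (f\<^sup>-\<^sup>1 \<oplus>\<^sub>m g\<^sup>-\<^sup>1) = \<one> (A \<oplus> B)"
    by (rule Pr_jointly_monic[of A B]) (use ty obj in simp_all)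
  have 2: "(f\<^sup>-\<^sup>1 \<oplus>\<^sub>m g\<^sup>-\<^sup>1) \<Zsemi> (f \<oplus>\<^sub>m g) = \<one> (A' \<oplus> B')"
    by (rule Pr_jointly_monic[of A' B']) (use ty obj in simp_all)
  have h: "f \<oplus>\<^sub>m g \<in> Hom (A \<oplus> B) (A' \<oplus> B')" "f\<^sup>-\<^sup>1 \<oplus>\<^sub>m g\<^sup>-\<^sup>1 \<in> Hom (A' \<oplus> B') (A \<oplus> B)"
    using ty by (simp_all add: in_Hom_iff)
  from h 1 2 show "iso_arr \<C> (A \<oplus> B) (A' \<oplus> B') (f \<oplus>\<^sub>m g)" by (rule iso_arrI)
  from h 1 2 show "(f \<oplus>\<^sub>m g)\<^sup>-\<^sup>1 = f\<^sup>-\<^sup>1 \<oplus>\<^sub>m g\<^sup>-\<^sup>1" by (rule inverse_unique)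
qed

lemma symS_props:
  assumes "A \<in> Obj \<C>" "B \<in> Obj \<C>"
  shows "\<gamma>\<^sup>\<oplus> A B \<in> Hom (A \<oplus> B) (B \<oplus> A) \<and>
    \<gamma>\<^sup>\<oplus> A B \<Zsemi> p\<^sub>1 B A = p\<^sub>2 A B \<and> \<gamma>\<^sup>\<oplus> A B \<Zsemi> p\<^sub>2 B A = p\<^sub>1 A B"
  unfolding symS_def by (rule theI', rule ex1_pairing) (use assms in simp_all)

lemma symS_typing [simp]:
  assumes "A \<in> Obj \<C>" "B \<in> Obj \<C>"
  shows "\<gamma>\<^sup>\<oplus> A B \<in> Arr \<C>" "Dom \<C> (\<gamma>\<^sup>\<oplus> A B) = A \<oplus> B" "Cod \<C> (\<gamma>\<^sup>\<oplus> A B) = B \<oplus> A"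
  using symS_props[OF assms] by (auto simp: in_Hom_iff)

lemma symS_Pr [simp]:
  assumes "A \<in> Obj \<C>" "B \<in> Obj \<C>"
  shows "\<gamma>\<^sup>\<oplus> A B \<Zsemi> p\<^sub>1 B A = p\<^sub>2 A B" "\<gamma>\<^sup>\<oplus> A B \<Zsemi> p\<^sub>2 B A = p\<^sub>1 A B"
  using symS_props[OF assms] by auto

lemma symS_Pr_extend [simp]:
  assumes "A \<in> Obj \<C>" "B \<in> Obj \<C>" "k \<in> Arr \<C>"
  shows "Dom \<C> k = B \<Longrightarrow> \<gamma>\<^sup>\<oplus> A B \<Zsemi> (p\<^sub>1 B A \<Zsemi> k) = p\<^sub>2 A B \<Zsemi> k"
    and "Dom \<C> k = A \<Longrightarrow> \<gamma>\<^sup>\<oplus> A B \<Zsemi> (p\<^sub>2 B A \<Zsemi> k) = p\<^sub>1 A B \<Zsemi> k"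
  using assms by (simp_all add: Comp_extend[OF symS_Pr(1)] Comp_extend[OF symS_Pr(2)])

lemma symS_symS:
  assumes "A \<in> Obj \<C>" "B \<in> Obj \<C>"
  shows "\<gamma>\<^sup>\<oplus> A B \<Zsemi> \<gamma>\<^sup>\<oplus> B A = \<one> (A \<oplus> B)"
  by (rule Pr_jointly_monic[of A B]) (use assms in simp_all)

lemma
  assumes "A \<in> Obj \<C>" "B \<in> Obj \<C>"
  shows iso_arr_symS: "iso_arr \<C> (A \<oplus> B) (B \<oplus> A) (\<gamma>\<^sup>\<oplus> A B)"
    and inverse_symS: "(\<gamma>\<^sup>\<oplus> A B)\<^sup>-\<^sup>1 = \<gamma>\<^sup>\<oplus> B A"
proof -
  have "\<gamma>\<^sup>\<oplus> A B \<in> Hom (A \<oplus> B) (B \<oplus> A)" "\<gamma>\<^sup>\<oplus> B A \<in> Hom (B \<oplus> A) (A \<oplus> B)"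
    using assms by (simp_all add: in_Hom_iff)
  then show "iso_arr \<C> (A \<oplus> B) (B \<oplus> A) (\<gamma>\<^sup>\<oplus> A B)" "(\<gamma>\<^sup>\<oplus> A B)\<^sup>-\<^sup>1 = \<gamma>\<^sup>\<oplus> B A"
    using assms iso_arrI inverse_unique symS_symS by blast+
qed

lemma assocS_props:
  assumes "A \<in> Obj \<C>" "B \<in> Obj \<C>" "C \<in> Obj \<C>"
  shows "\<alpha>\<^sup>\<oplus> A B C \<in> Hom ((A \<oplus> B) \<oplus> C) (A \<oplus> (B \<oplus> C)) \<and>
    \<alpha>\<^sup>\<oplus> A B C \<Zsemi> p\<^sub>1 A (B \<oplus> C) = p\<^sub>1 (A \<oplus> B) C \<Zsemi> p\<^sub>1 A B \<and>
    \<alpha>\<^sup>\<oplus> A B C \<Zsemi> p\<^sub>2 A (B \<oplus> C) \<Zsemi> p\<^sub>1 B C = p\<^sub>1 (A \<oplus> B) C \<Zsemi> p\<^sub>2 A B \<and>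
    \<alpha>\<^sup>\<oplus> A B C \<Zsemi> p\<^sub>2 A (B \<oplus> C) \<Zsemi> p\<^sub>2 B C = p\<^sub>2 (A \<oplus> B) C"
  unfolding assocS_def
proof (rule theI')
  let ?X = "(A \<oplus> B) \<oplus> C"
  \<comment> \<open>The three components form a nested pair: \<open>k\<close> collects those in
    \<open>B\<close> and \<open>C\<close>, and \<open>h\<close> pairs the one in \<open>A\<close>
    with \<open>k\<close>.\<close>
  obtain k where k: "k \<in> Hom ?X (B \<oplus> C)" "k \<Zsemi> p\<^sub>1 B C = p\<^sub>1 (A \<oplus> B) C \<Zsemi> p\<^sub>2 A B"
      "k \<Zsemi> p\<^sub>2 B C = p\<^sub>2 (A \<oplus> B) C"
    using ex1_pairing[of "p\<^sub>1 (A \<oplus> B) C \<Zsemi> p\<^sub>2 A B" "p\<^sub>2 (A \<oplus> B) C" ?X B C] assms by auto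
  obtain h where h: "h \<in> Hom ?X (A \<oplus> (B \<oplus> C))" "h \<Zsemi> p\<^sub>1 A (B \<oplus> C) = p\<^sub>1 (A \<oplus> B) C \<Zsemi> p\<^sub>1 A B"
      "h \<Zsemi> p\<^sub>2 A (B \<oplus> C) = k"
    using ex1_pairing[of "p\<^sub>1 (A \<oplus> B) C \<Zsemi> p\<^sub>1 A B" k ?X A "B \<oplus> C"] assms k(1)
    by (auto simp: in_Hom_iff)
  show "\<exists>!h. h \<in> Hom ?X (A \<oplus> (B \<oplus> C)) \<and>
      h \<Zsemi> p\<^sub>1 A (B \<oplus> C) = p\<^sub>1 (A \<oplus> B) C \<Zsemi> p\<^sub>1 A B \<and>
      h \<Zsemi> p\<^sub>2 A (B \<oplus> C) \<Zsemi> p\<^sub>1 B C = p\<^sub>1 (A \<oplus> B) C \<Zsemi> p\<^sub>2 A B \<and>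
      h \<Zsemi> p\<^sub>2 A (B \<oplus> C) \<Zsemi> p\<^sub>2 B C = p\<^sub>2 (A \<oplus> B) C"
  proof (rule ex1I[of _ h])
    fix h'
    assume h': "h' \<in> Hom ?X (A \<oplus> (B \<oplus> C)) \<and>
      h' \<Zsemi> p\<^sub>1 A (B \<oplus> C) = p\<^sub>1 (A \<oplus> B) C \<Zsemi> p\<^sub>1 A B \<and>
      h' \<Zsemi> p\<^sub>2 A (B \<oplus> C) \<Zsemi> p\<^sub>1 B C = p\<^sub>1 (A \<oplus> B) C \<Zsemi> p\<^sub>2 A B \<and>
      h' \<Zsemi> p\<^sub>2 A (B \<oplus> C) \<Zsemi> p\<^sub>2 B C = p\<^sub>2 (A \<oplus> B) C"
    with h k show "h' = h"
      by (intro Pr_jointly_monic_nested[of A B C h' h]) (use assms in \<open>simp_all add: in_Hom_iff\<close>)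
  qed (use h k in simp)
qed

lemma assocS_typing [simp]:
  assumes "A \<in> Obj \<C>" "B \<in> Obj \<C>" "C \<in> Obj \<C>"
  shows "\<alpha>\<^sup>\<oplus> A B C \<in> Arr \<C>" "Dom \<C> (\<alpha>\<^sup>\<oplus> A B C) = (A \<oplus> B) \<oplus> C"
    "Cod \<C> (\<alpha>\<^sup>\<oplus> A B C) = A \<oplus> (B \<oplus> C)"
  using assocS_props[OF assms] by (auto simp: in_Hom_iff)

lemma assocS_Pr [simp]:
  assumes "A \<in> Obj \<C>" "B \<in> Obj \<C>" "C \<in> Obj \<C>"
  shows "\<alpha>\<^sup>\<oplus> A B C \<Zsemi> p\<^sub>1 A (B \<oplus> C) = p\<^sub>1 (A \<oplus> B) C \<Zsemi> p\<^sub>1 A B"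
    and "\<alpha>\<^sup>\<oplus> A B C \<Zsemi> (p\<^sub>2 A (B \<oplus> C) \<Zsemi> p\<^sub>1 B C) = p\<^sub>1 (A \<oplus> B) C \<Zsemi> p\<^sub>2 A B"
    and "\<alpha>\<^sup>\<oplus> A B C \<Zsemi> (p\<^sub>2 A (B \<oplus> C) \<Zsemi> p\<^sub>2 B C) = p\<^sub>2 (A \<oplus> B) C"
  using assocS_props[OF assms] assms by simp_all

lemma assocS_Pr_extend [simp]:
  assumes obj: "A \<in> Obj \<C>" "B \<in> Obj \<C>" "C \<in> Obj \<C>" and k: "k \<in> Arr \<C>"
  shows "Dom \<C> k = A \<Longrightarrow>
      \<alpha>\<^sup>\<oplus> A B C \<Zsemi> (p\<^sub>1 A (B \<oplus> C) \<Zsemi> k) = p\<^sub>1 (A \<oplus> B) C \<Zsemi> (p\<^sub>1 A B \<Zsemi> k)"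
    and "Dom \<C> k = B \<Longrightarrow>
      \<alpha>\<^sup>\<oplus> A B C \<Zsemi> (p\<^sub>2 A (B \<oplus> C) \<Zsemi> (p\<^sub>1 B C \<Zsemi> k)) = p\<^sub>1 (A \<oplus> B) C \<Zsemi> (p\<^sub>2 A B \<Zsemi> k)"
    and "Dom \<C> k = C \<Longrightarrow>
      \<alpha>\<^sup>\<oplus> A B C \<Zsemi> (p\<^sub>2 A (B \<oplus> C) \<Zsemi> (p\<^sub>2 B C \<Zsemi> k)) = p\<^sub>2 (A \<oplus> B) C \<Zsemi> k"
  using Comp_extend[OF assocS_Pr(1)[OF obj], of k] Comp_extend[OF assocS_Pr(2)[OF obj], of k]
    Comp_extend[OF assocS_Pr(3)[OF obj], of k] assms by auto

text \<open>The inverse \<open>h\<close> is the nested pair with the mirrored bracketing,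
  \<open>k\<close> being its component in \<open>A \<oplus> B\<close>.\<close>

lemma iso_arr_assocS:
  assumes "A \<in> Obj \<C>" "B \<in> Obj \<C>" "C \<in> Obj \<C>"
  shows "iso_arr \<C> ((A \<oplus> B) \<oplus> C) (A \<oplus> (B \<oplus> C)) (\<alpha>\<^sup>\<oplus> A B C)"
proof -
  let ?Y = "A \<oplus> (B \<oplus> C)"
  obtain k where k: "k \<in> Hom ?Y (A \<oplus> B)" "k \<Zsemi> p\<^sub>1 A B = p\<^sub>1 A (B \<oplus> C)"
      "k \<Zsemi> p\<^sub>2 A B = p\<^sub>2 A (B \<oplus> C) \<Zsemi> p\<^sub>1 B C"
    using ex1_pairing[of "p\<^sub>1 A (B \<oplus> C)" "p\<^sub>2 A (B \<oplus> C) \<Zsemi> p\<^sub>1 B C" ?Y A B] assms by auto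
  obtain h where h: "h \<in> Hom ?Y ((A \<oplus> B) \<oplus> C)" "h \<Zsemi> p\<^sub>1 (A \<oplus> B) C = k"
      "h \<Zsemi> p\<^sub>2 (A \<oplus> B) C = p\<^sub>2 A (B \<oplus> C) \<Zsemi> p\<^sub>2 B C"
    using ex1_pairing[of k "p\<^sub>2 A (B \<oplus> C) \<Zsemi> p\<^sub>2 B C" ?Y "A \<oplus> B" C] assms k(1)
    by (auto simp: in_Hom_iff)
  note ty = k(1)[unfolded in_Hom_iff] h(1)[unfolded in_Hom_iff]
  \<comment> \<open>The obtained \<open>h\<close> has no rule for composites that continue after its
    first component, so one is supplied by hand.\<close>
  have hk: "h \<Zsemi> (p\<^sub>1 (A \<oplus> B) C \<Zsemi> m) = k \<Zsemi> m" if "m \<in> Arr \<C>" "Dom \<C> m = A \<oplus> B" for m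
    using Comp_extend[OF h(2)] ty assms that by simp
  have 1: "\<alpha>\<^sup>\<oplus> A B C \<Zsemi> k = p\<^sub>1 (A \<oplus> B) C"
    by (rule Pr_jointly_monic[of A B]) (use assms ty k in simp_all)
  have 2: "\<alpha>\<^sup>\<oplus> A B C \<Zsemi> h = \<one> ((A \<oplus> B) \<oplus> C)"
    by (rule Pr_jointly_monic[of "A \<oplus> B" C]) (use assms ty h 1 in simp_all)
  \<comment> \<open>This is the second component of
    \<open>h \<Zsemi> \<alpha>\<^sup>\<oplus> A B C\<close>. It lands in a biproduct again and is
    compared there, as the first component of the other composite was above.\<close>
  have 3: "h \<Zsemi> (\<alpha>\<^sup>\<oplus> A B C \<Zsemi> p\<^sub>2 A (B \<oplus> C)) = p\<^sub>2 A (B \<oplus> C)"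
    by (rule Pr_jointly_monic[of B C]) (use assms ty h hk k in simp_all)
  have 4: "h \<Zsemi> \<alpha>\<^sup>\<oplus> A B C = \<one> (A \<oplus> (B \<oplus> C))"
    by (rule Pr_jointly_monic[of A "B \<oplus> C"]) (use assms ty h hk k 3 in simp_all)
  show ?thesis
    by (rule iso_arrI[OF _ h(1) 2 4]) (use assms in \<open>simp add: in_Hom_iff\<close>)
qed

lemma inverse_assocS_typing [simp]:
  assumes "A \<in> Obj \<C>" "B \<in> Obj \<C>" "C \<in> Obj \<C>"
  shows "(\<alpha>\<^sup>\<oplus> A B C)\<^sup>-\<^sup>1 \<in> Arr \<C>" "Dom \<C> ((\<alpha>\<^sup>\<oplus> A B C)\<^sup>-\<^sup>1) = A \<oplus> (B \<oplus> C)"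
    "Cod \<C> ((\<alpha>\<^sup>\<oplus> A B C)\<^sup>-\<^sup>1) = (A \<oplus> B) \<oplus> C"
  by (rule iso_inverse[OF iso_arr_assocS[OF assms]])+

text \<open>Cancel the associator in \<open>(\<alpha>\<^sup>\<oplus> A B C)\<^sup>-\<^sup>1 \<Zsemi>
  (\<alpha>\<^sup>\<oplus> A B C \<Zsemi> m)\<close> for the three projections \<open>m\<close> of
  its target; the projection rules of the associator turn the bracket into the left-hand
  side.\<close>

lemma inverse_assocS_Pr [simp]:
  assumes obj: "A \<in> Obj \<C>" "B \<in> Obj \<C>" "C \<in> Obj \<C>"
  shows "(\<alpha>\<^sup>\<oplus> A B C)\<^sup>-\<^sup>1 \<Zsemi> (p\<^sub>1 (A \<oplus> B) C \<Zsemi> p\<^sub>1 A B) = p\<^sub>1 A (B \<oplus> C)"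
    and "(\<alpha>\<^sup>\<oplus> A B C)\<^sup>-\<^sup>1 \<Zsemi> (p\<^sub>1 (A \<oplus> B) C \<Zsemi> p\<^sub>2 A B) = p\<^sub>2 A (B \<oplus> C) \<Zsemi> p\<^sub>1 B C"
    and "(\<alpha>\<^sup>\<oplus> A B C)\<^sup>-\<^sup>1 \<Zsemi> p\<^sub>2 (A \<oplus> B) C = p\<^sub>2 A (B \<oplus> C) \<Zsemi> p\<^sub>2 B C"
  using iso_inverse_extend(2)[OF iso_arr_assocS[OF obj], of "p\<^sub>1 A (B \<oplus> C)"]
    iso_inverse_extend(2)[OF iso_arr_assocS[OF obj], of "p\<^sub>2 A (B \<oplus> C) \<Zsemi> p\<^sub>1 B C"]
    iso_inverse_extend(2)[OF iso_arr_assocS[OF obj], of "p\<^sub>2 A (B \<oplus> C) \<Zsemi> p\<^sub>2 B C"] obj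
  by simp_all

lemma inverse_assocS_Pr_extend [simp]:
  assumes obj: "A \<in> Obj \<C>" "B \<in> Obj \<C>" "C \<in> Obj \<C>" and k: "k \<in> Arr \<C>"
  shows "Dom \<C> k = A \<Longrightarrow>
      (\<alpha>\<^sup>\<oplus> A B C)\<^sup>-\<^sup>1 \<Zsemi> (p\<^sub>1 (A \<oplus> B) C \<Zsemi> (p\<^sub>1 A B \<Zsemi> k)) = p\<^sub>1 A (B \<oplus> C) \<Zsemi> k"
    and "Dom \<C> k = B \<Longrightarrow>
      (\<alpha>\<^sup>\<oplus> A B C)\<^sup>-\<^sup>1 \<Zsemi> (p\<^sub>1 (A \<oplus> B) C \<Zsemi> (p\<^sub>2 A B \<Zsemi> k)) = p\<^sub>2 A (B \<oplus> C) \<Zsemi> (p\<^sub>1 B C \<Zsemi> k)"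
    and "Dom \<C> k = C \<Longrightarrow>
      (\<alpha>\<^sup>\<oplus> A B C)\<^sup>-\<^sup>1 \<Zsemi> (p\<^sub>2 (A \<oplus> B) C \<Zsemi> k) = p\<^sub>2 A (B \<oplus> C) \<Zsemi> (p\<^sub>2 B C \<Zsemi> k)"
  using Comp_extend[OF inverse_assocS_Pr(1)[OF obj], of k]
    Comp_extend[OF inverse_assocS_Pr(2)[OF obj], of k]
    Comp_extend[OF inverse_assocS_Pr(3)[OF obj], of k] assms by auto

section \<open>Coherence of the direct sum\<close>

lemma assocS_pentagon:
  assumes [simp]: "A \<in> Obj \<C>" "B \<in> Obj \<C>" "C \<in> Obj \<C>" "D \<in> Obj \<C>"
  shows "\<alpha>\<^sup>\<oplus> (A \<oplus> B) C D \<Zsemi> \<alpha>\<^sup>\<oplus> A B (C \<oplus> D)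
    = (\<alpha>\<^sup>\<oplus> A B C \<oplus>\<^sub>m \<one> D) \<Zsemi> \<alpha>\<^sup>\<oplus> A (B \<oplus> C) D \<Zsemi> (\<one> A \<oplus>\<^sub>m \<alpha>\<^sup>\<oplus> B C D)"
  (is "?l = ?r")
proof (rule Pr_jointly_monic_nested[of A B "C \<oplus> D"])
  \<comment> \<open>The nested rule separates three summands; the last of them is
    \<open>C \<oplus> D\<close>, so this component is split again.\<close>
  show "?l \<Zsemi> p\<^sub>2 A (B \<oplus> (C \<oplus> D)) \<Zsemi> p\<^sub>2 B (C \<oplus> D) = ?r \<Zsemi> p\<^sub>2 A (B \<oplus> (C \<oplus> D)) \<Zsemi> p\<^sub>2 B (C \<oplus> D)"
    by (rule Pr_jointly_monic[of C D]) simp_all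
qed simp_all

lemma assocS_symS_hexagon:
  assumes [simp]: "A \<in> Obj \<C>" "B \<in> Obj \<C>" "C \<in> Obj \<C>"
  shows "\<alpha>\<^sup>\<oplus> A B C \<Zsemi> \<gamma>\<^sup>\<oplus> A (B \<oplus> C) \<Zsemi> \<alpha>\<^sup>\<oplus> B C A
    = (\<gamma>\<^sup>\<oplus> A B \<oplus>\<^sub>m \<one> C) \<Zsemi> \<alpha>\<^sup>\<oplus> B A C \<Zsemi> (\<one> B \<oplus>\<^sub>m \<gamma>\<^sup>\<oplus> A C)"
  by (rule Pr_jointly_monic_nested[of B C A]) simp_all

lemma assocS_unit_triangle:
  assumes [simp]: "A \<in> Obj \<C>" "B \<in> Obj \<C>"
  shows "\<alpha>\<^sup>\<oplus> A \<zero> B \<Zsemi> (\<one> A \<oplus>\<^sub>m \<lambda>\<^sup>\<oplus> B) = \<rho>\<^sup>\<oplus> A \<oplus>\<^sub>m \<one> B"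
  by (rule Pr_jointly_monic[of A B]) (simp_all add: lunitS_def runitS_def)

end

section \<open>Tensor product and braiding as rewrite rules\<close>

locale additive_braided_category =
  biproduct_category \<C> + braided_monoidal_category \<C> + additive_tensor \<C>
  for \<C> :: "('o, 'm, 'x) bimonoidal_cat_scheme" (structure)
begin

lemmas UnitO_Obj [simp] TensorO_Obj [simp] TensorM_Ident [simp]

lemma TensorM_typing [simp]:
  assumes "f \<in> Arr \<C>" "g \<in> Arr \<C>"
  shows "f \<otimes>\<^sub>m g \<in> Arr \<C>" "Dom \<C> (f \<otimes>\<^sub>m g) = Dom \<C> f \<otimes> Dom \<C> g"
    "Cod \<C> (f \<otimes>\<^sub>m g) = Cod \<C> f \<otimes> Cod \<C> g"
  using TensorM_Hom[of f "Dom \<C> f" "Cod \<C> f" g "Dom \<C> g" "Cod \<C> g"] assms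
  by (auto simp: in_Hom_iff)

text \<open>Functoriality oriented to fuse consecutive tensor factors: each slot becomes an ordinary
  composite in which identities and projections simplify separately.\<close>

lemma TensorM_interchange [simp]:
  assumes "f \<in> Arr \<C>" "g \<in> Arr \<C>" "f' \<in> Arr \<C>" "g' \<in> Arr \<C>" "Cod \<C> f = Dom \<C> f'" "Cod \<C> g = Dom \<C> g'"
  shows "(f \<otimes>\<^sub>m g) \<Zsemi> (f' \<otimes>\<^sub>m g') = (f \<Zsemi> f') \<otimes>\<^sub>m (g \<Zsemi> g')"
  by (rule TensorM_Comp[symmetric]) (use assms in \<open>auto simp: in_Hom_iff\<close>)

lemma assocT_typing [simp]:
  assumes "A \<in> Obj \<C>" "B \<in> Obj \<C>" "C \<in> Obj \<C>"
  shows "\<alpha>\<^sup>\<otimes> A B C \<in> Arr \<C>" "Dom \<C> (\<alpha>\<^sup>\<otimes> A B C) = (A \<otimes> B) \<otimes> C"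
    "Cod \<C> (\<alpha>\<^sup>\<otimes> A B C) = A \<otimes> (B \<otimes> C)"
  by (rule iso_inverse[OF assocT_iso[OF assms]])+

lemma lunitT_typing [simp]:
  assumes "A \<in> Obj \<C>"
  shows "\<lambda>\<^sup>\<otimes> A \<in> Arr \<C>" "Dom \<C> (\<lambda>\<^sup>\<otimes> A) = \<I> \<otimes> A" "Cod \<C> (\<lambda>\<^sup>\<otimes> A) = A"
  by (rule iso_inverse[OF lunitT_iso[OF assms]])+

lemma braidT_typing [simp]:
  assumes "A \<in> Obj \<C>" "B \<in> Obj \<C>"
  shows "\<gamma>\<^sup>\<otimes> A B \<in> Arr \<C>" "Dom \<C> (\<gamma>\<^sup>\<otimes> A B) = A \<otimes> B" "Cod \<C> (\<gamma>\<^sup>\<otimes> A B) = B \<otimes> A"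
    and "(\<gamma>\<^sup>\<otimes> A B)\<^sup>-\<^sup>1 \<in> Arr \<C>" "Dom \<C> ((\<gamma>\<^sup>\<otimes> A B)\<^sup>-\<^sup>1) = B \<otimes> A" "Cod \<C> ((\<gamma>\<^sup>\<otimes> A B)\<^sup>-\<^sup>1) = A \<otimes> B"
  by (rule iso_inverse[OF braidT_iso[OF assms]])+

lemma braidT_inverse [simp]:
  assumes "A \<in> Obj \<C>" "B \<in> Obj \<C>"
  shows "\<gamma>\<^sup>\<otimes> A B \<Zsemi> (\<gamma>\<^sup>\<otimes> A B)\<^sup>-\<^sup>1 = \<one> (A \<otimes> B)"
  by (rule iso_inverse[OF braidT_iso[OF assms]])

text \<open>The naturality rules below are oriented so that tensor products of morphisms move to the left.\<close>

lemma assocT_TensorM [simp]: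
  assumes "f \<in> Arr \<C>" "g \<in> Arr \<C>" "h \<in> Arr \<C>" "Dom \<C> f = A" "Dom \<C> g = B" "Dom \<C> h = C"
  shows "\<alpha>\<^sup>\<otimes> A B C \<Zsemi> (f \<otimes>\<^sub>m (g \<otimes>\<^sub>m h)) = ((f \<otimes>\<^sub>m g) \<otimes>\<^sub>m h) \<Zsemi> \<alpha>\<^sup>\<otimes> (Cod \<C> f) (Cod \<C> g) (Cod \<C> h)"
  by (rule assocT_natural[symmetric]) (use assms in \<open>auto simp: in_Hom_iff\<close>)

lemma braidT_TensorM [simp]:
  assumes "f \<in> Arr \<C>" "g \<in> Arr \<C>" "Dom \<C> f = A" "Dom \<C> g = B"
  shows "\<gamma>\<^sup>\<otimes> A B \<Zsemi> (g \<otimes>\<^sub>m f) = (f \<otimes>\<^sub>m g) \<Zsemi> \<gamma>\<^sup>\<otimes> (Cod \<C> f) (Cod \<C> g)"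
  by (rule braidT_natural[symmetric]) (use assms in \<open>auto simp: in_Hom_iff\<close>)

lemma braidT_TensorM_extend [simp]:
  assumes "f \<in> Arr \<C>" "g \<in> Arr \<C>" "Dom \<C> f = A" "Dom \<C> g = B" "k \<in> Arr \<C>" "Dom \<C> k = Cod \<C> g \<otimes> Cod \<C> f"
  shows "\<gamma>\<^sup>\<otimes> A B \<Zsemi> ((g \<otimes>\<^sub>m f) \<Zsemi> k) = (f \<otimes>\<^sub>m g) \<Zsemi> (\<gamma>\<^sup>\<otimes> (Cod \<C> f) (Cod \<C> g) \<Zsemi> k)"
  using Comp_extend[OF braidT_TensorM[OF assms(1-4)], of k] assms by auto

lemma
  assumes f: "iso_arr \<C> A A' f" and g: "iso_arr \<C> B B' g"
  shows iso_arr_TensorM: "iso_arr \<C> (A \<otimes> B) (A' \<otimes> B') (f \<otimes>\<^sub>m g)"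
    and inverse_TensorM: "(f \<otimes>\<^sub>m g)\<^sup>-\<^sup>1 = f\<^sup>-\<^sup>1 \<otimes>\<^sub>m g\<^sup>-\<^sup>1"
proof -
  note ty = iso_inverse[OF f] iso_inverse[OF g]
  have obj: "A \<in> Obj \<C>" "A' \<in> Obj \<C>" "B \<in> Obj \<C>" "B' \<in> Obj \<C>" using ty by auto
  have "(f \<otimes>\<^sub>m g) \<Zsemi> (f\<^sup>-\<^sup>1 \<otimes>\<^sub>m g\<^sup>-\<^sup>1) = \<one> (A \<otimes> B)" "(f\<^sup>-\<^sup>1 \<otimes>\<^sub>m g\<^sup>-\<^sup>1) \<Zsemi> (f \<otimes>\<^sub>m g) = \<one> (A' \<otimes> B')"
    "f \<otimes>\<^sub>m g \<in> Hom (A \<otimes> B) (A' \<otimes> B')" "f\<^sup>-\<^sup>1 \<otimes>\<^sub>m g\<^sup>-\<^sup>1 \<in> Hom (A' \<otimes> B') (A \<otimes> B)"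
    using ty obj by (simp_all add: in_Hom_iff)
  then show "iso_arr \<C> (A \<otimes> B) (A' \<otimes> B') (f \<otimes>\<^sub>m g)" "(f \<otimes>\<^sub>m g)\<^sup>-\<^sup>1 = f\<^sup>-\<^sup>1 \<otimes>\<^sub>m g\<^sup>-\<^sup>1"
    using iso_arrI inverse_unique by blast+
qed

text \<open>Both sides are the inverses of the two sides of the second hexagon at \<open>B, C, A\<close>.\<close>

lemma inverse_braidT_hexagon:
  assumes [simp]: "A \<in> Obj \<C>" "B \<in> Obj \<C>" "C \<in> Obj \<C>"
  shows "\<alpha>\<^sup>\<otimes> A B C \<Zsemi> (\<gamma>\<^sup>\<otimes> (B \<otimes> C) A)\<^sup>-\<^sup>1 \<Zsemi> \<alpha>\<^sup>\<otimes> B C A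
    = ((\<gamma>\<^sup>\<otimes> B A)\<^sup>-\<^sup>1 \<otimes>\<^sub>m \<one> C) \<Zsemi> \<alpha>\<^sup>\<otimes> B A C \<Zsemi> (\<one> B \<otimes>\<^sub>m (\<gamma>\<^sup>\<otimes> C A)\<^sup>-\<^sup>1)"
proof -
  note [simp] = inverse_inverse[OF assocT_iso]
  note a = iso_arr_inverse[OF assocT_iso]
  have 1: "iso_arr \<C> (B \<otimes> (C \<otimes> A)) (A \<otimes> (B \<otimes> C)) ((\<alpha>\<^sup>\<otimes> B C A)\<^sup>-\<^sup>1 \<Zsemi> \<gamma>\<^sup>\<otimes> (B \<otimes> C) A)"
    by (rule iso_arr_Comp[OF a braidT_iso]) simp_all
  have 2: "((\<alpha>\<^sup>\<otimes> B C A)\<^sup>-\<^sup>1 \<Zsemi> \<gamma>\<^sup>\<otimes> (B \<otimes> C) A)\<^sup>-\<^sup>1 = (\<gamma>\<^sup>\<otimes> (B \<otimes> C) A)\<^sup>-\<^sup>1 \<Zsemi> \<alpha>\<^sup>\<otimes> B C A"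
    by (subst inverse_Comp[OF a braidT_iso]) simp_all
  have 3: "((\<alpha>\<^sup>\<otimes> B C A)\<^sup>-\<^sup>1 \<Zsemi> \<gamma>\<^sup>\<otimes> (B \<otimes> C) A \<Zsemi> (\<alpha>\<^sup>\<otimes> A B C)\<^sup>-\<^sup>1)\<^sup>-\<^sup>1
      = \<alpha>\<^sup>\<otimes> A B C \<Zsemi> ((\<gamma>\<^sup>\<otimes> (B \<otimes> C) A)\<^sup>-\<^sup>1 \<Zsemi> \<alpha>\<^sup>\<otimes> B C A)"
    by (subst inverse_Comp[OF 1 a]) (simp_all only: 2, simp_all)
  note b = iso_arr_TensorM[OF iso_arr_Ident braidT_iso] and c = iso_arr_TensorM[OF braidT_iso iso_arr_Ident]
  have 4: "iso_arr \<C> (B \<otimes> (C \<otimes> A)) ((B \<otimes> A) \<otimes> C) ((\<one> B \<otimes>\<^sub>m \<gamma>\<^sup>\<otimes> C A) \<Zsemi> (\<alpha>\<^sup>\<otimes> B A C)\<^sup>-\<^sup>1)"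
    by (rule iso_arr_Comp[OF b a]) simp_all
  have 5: "((\<one> B \<otimes>\<^sub>m \<gamma>\<^sup>\<otimes> C A) \<Zsemi> (\<alpha>\<^sup>\<otimes> B A C)\<^sup>-\<^sup>1)\<^sup>-\<^sup>1 = \<alpha>\<^sup>\<otimes> B A C \<Zsemi> (\<one> B \<otimes>\<^sub>m (\<gamma>\<^sup>\<otimes> C A)\<^sup>-\<^sup>1)"
    by (subst inverse_Comp[OF b a]) (simp_all add: inverse_TensorM[OF iso_arr_Ident braidT_iso])
  have 6: "((\<one> B \<otimes>\<^sub>m \<gamma>\<^sup>\<otimes> C A) \<Zsemi> (\<alpha>\<^sup>\<otimes> B A C)\<^sup>-\<^sup>1 \<Zsemi> (\<gamma>\<^sup>\<otimes> B A \<otimes>\<^sub>m \<one> C))\<^sup>-\<^sup>1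
      = ((\<gamma>\<^sup>\<otimes> B A)\<^sup>-\<^sup>1 \<otimes>\<^sub>m \<one> C) \<Zsemi> (\<alpha>\<^sup>\<otimes> B A C \<Zsemi> (\<one> B \<otimes>\<^sub>m (\<gamma>\<^sup>\<otimes> C A)\<^sup>-\<^sup>1))"
    by (subst inverse_Comp[OF 4 c]) (simp_all add: 5 inverse_TensorM[OF braidT_iso iso_arr_Ident])
  show ?thesis using hexagon2[of B C A] 3 6 by simp
qed

section \<open>Annihilation and distributivity: well-definedness\<close>

lemma zero_object_TensorO_right:
  assumes A: "A \<in> Obj \<C>"
  shows "zero_object \<C> (A \<otimes> \<zero>)"
proof (rule zero_objectI)
  let ?z = "ZeroM \<C> \<zero> \<zero>"
  have "\<one> \<zero> = ?z" by (rule zero_object_into_unique[OF zero_object_ZeroO]) simp_all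
  \<comment> \<open>As \<open>?z \<boxplus> ?z = ?z\<close>, additivity makes
    \<open>\<one> A \<otimes>\<^sub>m ?z\<close> its own double.\<close>
  moreover have "\<one> A \<otimes>\<^sub>m ?z = ZeroM \<C> (A \<otimes> \<zero>) (A \<otimes> \<zero>)"
  proof (rule Add_absorb_imp_ZeroM[of "\<one> A \<otimes>\<^sub>m ?z"])
    show "(\<one> A \<otimes>\<^sub>m ?z) \<boxplus> (\<one> A \<otimes>\<^sub>m ?z) = \<one> A \<otimes>\<^sub>m ?z"
      using TensorM_Add_right[of A ?z \<zero> \<zero> ?z] A by (simp add: in_Hom_iff)
  qed (use A in \<open>simp_all add: in_Hom_iff\<close>)
  ultimately show "\<one> (A \<otimes> \<zero>) = ZeroM \<C> (A \<otimes> \<zero>) (A \<otimes> \<zero>)"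
    using TensorM_Ident[of A \<zero>] A by simp
qed (use A in simp)

lemma annih_typing [simp]:
  assumes "A \<in> Obj \<C>"
  shows "\<epsilon> A \<in> Arr \<C>" "Dom \<C> (\<epsilon> A) = A \<otimes> \<zero>" "Cod \<C> (\<epsilon> A) = \<zero>"
proof -
  have "\<exists>!h. h \<in> Hom (A \<otimes> \<zero>) \<zero>"
    using zero_object_ZeroO assms unfolding zero_object_def by simp
  then have "\<epsilon> A \<in> Hom (A \<otimes> \<zero>) \<zero>" unfolding annih_def by (rule theI')
  then show "\<epsilon> A \<in> Arr \<C>" "Dom \<C> (\<epsilon> A) = A \<otimes> \<zero>" "Cod \<C> (\<epsilon> A) = \<zero>"
    by (simp_all add: in_Hom_iff)
qed

lemma distl_props:
  assumes "A \<in> Obj \<C>" "B \<in> Obj \<C>" "C \<in> Obj \<C>"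
  shows "\<delta> A B C \<in> Hom (A \<otimes> (B \<oplus> C)) (A \<otimes> B \<oplus> A \<otimes> C) \<and>
    \<delta> A B C \<Zsemi> p\<^sub>1 (A \<otimes> B) (A \<otimes> C) = \<one> A \<otimes>\<^sub>m p\<^sub>1 B C \<and>
    \<delta> A B C \<Zsemi> p\<^sub>2 (A \<otimes> B) (A \<otimes> C) = \<one> A \<otimes>\<^sub>m p\<^sub>2 B C"
  unfolding distl_def by (rule theI', rule ex1_pairing) (use assms in simp_all)

lemma distl_typing [simp]:
  assumes "A \<in> Obj \<C>" "B \<in> Obj \<C>" "C \<in> Obj \<C>"
  shows "\<delta> A B C \<in> Arr \<C>" "Dom \<C> (\<delta> A B C) = A \<otimes> (B \<oplus> C)" "Cod \<C> (\<delta> A B C) = A \<otimes> B \<oplus> A \<otimes> C"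
  using distl_props[OF assms] by (auto simp: in_Hom_iff)

lemma distl_Pr [simp]:
  assumes "A \<in> Obj \<C>" "B \<in> Obj \<C>" "C \<in> Obj \<C>"
  shows "\<delta> A B C \<Zsemi> p\<^sub>1 (A \<otimes> B) (A \<otimes> C) = \<one> A \<otimes>\<^sub>m p\<^sub>1 B C"
    and "\<delta> A B C \<Zsemi> p\<^sub>2 (A \<otimes> B) (A \<otimes> C) = \<one> A \<otimes>\<^sub>m p\<^sub>2 B C"
  using distl_props[OF assms] by auto

lemma distl_Pr_extend [simp]:
  assumes "A \<in> Obj \<C>" "B \<in> Obj \<C>" "C \<in> Obj \<C>" "k \<in> Arr \<C>"
  shows "Dom \<C> k = A \<otimes> B \<Longrightarrow> \<delta> A B C \<Zsemi> (p\<^sub>1 (A \<otimes> B) (A \<otimes> C) \<Zsemi> k) = (\<one> A \<otimes>\<^sub>m p\<^sub>1 B C) \<Zsemi> k"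
    and "Dom \<C> k = A \<otimes> C \<Longrightarrow> \<delta> A B C \<Zsemi> (p\<^sub>2 (A \<otimes> B) (A \<otimes> C) \<Zsemi> k) = (\<one> A \<otimes>\<^sub>m p\<^sub>2 B C) \<Zsemi> k"
  using Comp_extend[OF distl_Pr(1)[OF assms(1-3)], of k]
    Comp_extend[OF distl_Pr(2)[OF assms(1-3)], of k] assms by auto

lemma double_braid_typing [simp]:
  assumes "A \<in> Obj \<C>" "B \<in> Obj \<C>"
  shows "\<beta> A B \<in> Arr \<C>" "Dom \<C> (\<beta> A B) = A \<otimes> B" "Cod \<C> (\<beta> A B) = A \<otimes> B"
  using assms by (simp_all add: double_braid_def)

section \<open>Distributivity laws\<close>

lemma distl_double_braid:
  assumes [simp]: "A \<in> Obj \<C>" "B \<in> Obj \<C>" "C \<in> Obj \<C>"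
  shows "\<delta> A B C \<Zsemi> (\<beta> A B \<oplus>\<^sub>m \<beta> A C) = \<beta> A (B \<oplus> C) \<Zsemi> \<delta> A B C"
  \<comment> \<open>A projection passing left through two braidings changes its slot twice, so it
    emerges again as \<open>\<one> A\<close> tensored with that projection, which is the component
    of \<open>\<delta> A B C\<close>.\<close>
  by (rule Pr_jointly_monic[of "A \<otimes> B" "A \<otimes> C"]) (simp_all add: double_braid_def)

lemma distl_symS:
  assumes [simp]: "A \<in> Obj \<C>" "B \<in> Obj \<C>" "C \<in> Obj \<C>"
  shows "\<delta> A B C = (\<one> A \<otimes>\<^sub>m \<gamma>\<^sup>\<oplus> B C) \<Zsemi> \<delta> A C B \<Zsemi> \<gamma>\<^sup>\<oplus> (A \<otimes> C) (A \<otimes> B)"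
  by (rule Pr_jointly_monic[of "A \<otimes> B" "A \<otimes> C"]) simp_all

text \<open>Each component of either side is \<open>\<one> A\<close> tensored with the projection of
  \<open>(B \<oplus> C) \<oplus> D\<close> onto one summand.\<close>

lemma distl_assocS:
  assumes [simp]: "A \<in> Obj \<C>" "B \<in> Obj \<C>" "C \<in> Obj \<C>" "D \<in> Obj \<C>"
  shows "(\<one> A \<otimes>\<^sub>m \<alpha>\<^sup>\<oplus> B C D) \<Zsemi> \<delta> A B (C \<oplus> D) \<Zsemi> (\<one> (A \<otimes> B) \<oplus>\<^sub>m \<delta> A C D)
    = \<delta> A (B \<oplus> C) D \<Zsemi> (\<delta> A B C \<oplus>\<^sub>m \<one> (A \<otimes> D)) \<Zsemi> \<alpha>\<^sup>\<oplus> (A \<otimes> B) (A \<otimes> C) (A \<otimes> D)"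
  by (rule Pr_jointly_monic_nested[of "A \<otimes> B" "A \<otimes> C" "A \<otimes> D"]) simp_all

lemma distl_runitS:
  assumes [simp]: "A \<in> Obj \<C>" "B \<in> Obj \<C>"
  shows "\<delta> A B \<zero> \<Zsemi> (\<one> (A \<otimes> B) \<oplus>\<^sub>m \<epsilon> A) \<Zsemi> \<rho>\<^sup>\<oplus> (A \<otimes> B) = \<one> A \<otimes>\<^sub>m \<rho>\<^sup>\<oplus> B"
  by (simp add: runitS_def)

text \<open>On the left, a component is the associator followed by
  \<open>\<one> A \<otimes>\<^sub>m (\<one> B \<otimes>\<^sub>m p)\<close> for a projection
  \<open>p\<close>; naturality puts \<open>\<one> (A \<otimes> B) \<otimes>\<^sub>m p\<close> in
  front of the associator, as on the right.\<close>

lemma distl_assocT: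
  assumes [simp]: "A \<in> Obj \<C>" "B \<in> Obj \<C>" "C \<in> Obj \<C>" "D \<in> Obj \<C>"
  shows "\<alpha>\<^sup>\<otimes> A B (C \<oplus> D) \<Zsemi> (\<one> A \<otimes>\<^sub>m \<delta> B C D) \<Zsemi> \<delta> A (B \<otimes> C) (B \<otimes> D)
    = \<delta> (A \<otimes> B) C D \<Zsemi> (\<alpha>\<^sup>\<otimes> A B C \<oplus>\<^sub>m \<alpha>\<^sup>\<otimes> A B D)"
  by (rule Pr_jointly_monic[of "A \<otimes> (B \<otimes> C)" "A \<otimes> (B \<otimes> D)"]) simp_all

lemma distl_lunitT:
  assumes [simp]: "A \<in> Obj \<C>" "B \<in> Obj \<C>"
  shows "\<delta> \<I> A B \<Zsemi> (\<lambda>\<^sup>\<otimes> A \<oplus>\<^sub>m \<lambda>\<^sup>\<otimes> B) = \<lambda>\<^sup>\<otimes> (A \<oplus> B)"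
  by (rule Pr_jointly_monic[of A B])
    \<comment> \<open>The source object occurs in the premise but not on the left-hand side of this
      naturality rule, so matching cannot find it and it is fixed by hand.\<close>
    (simp_all add: lunitT_natural[of _ "A \<oplus> B"] in_Hom_iff)

text \<open>Moving the inverses inside the sums makes the projection rules applicable: the inverse
  symmetry becomes the symmetry with exchanged arguments, and only inverses of associators
  remain.\<close>

lemma interchange_eq:
  assumes [simp]: "A \<in> Obj \<C>" "B \<in> Obj \<C>" "C \<in> Obj \<C>" "D \<in> Obj \<C>"
  defines "P \<equiv> A \<otimes> C" and "Q \<equiv> A \<otimes> D" and "R \<equiv> B \<otimes> C" and "S \<equiv> B \<otimes> D"
  shows "\<sigma> A B C D = (\<alpha>\<^sup>\<oplus> (P \<oplus> Q) R S)\<^sup>-\<^sup>1 \<Zsemi> (\<alpha>\<^sup>\<oplus> P Q R \<oplus>\<^sub>m \<one> S)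
    \<Zsemi> ((\<one> P \<oplus>\<^sub>m \<gamma>\<^sup>\<oplus> Q R) \<oplus>\<^sub>m \<one> S) \<Zsemi> ((\<alpha>\<^sup>\<oplus> P R Q)\<^sup>-\<^sup>1 \<oplus>\<^sub>m \<one> S) \<Zsemi> \<alpha>\<^sup>\<oplus> (P \<oplus> R) Q S"
  by (simp add: interchange_def Let_def P_def Q_def R_def S_def inverse_symS
        inverse_SumM[OF iso_arr_SumM[OF iso_arr_Ident iso_arr_symS] iso_arr_Ident]
        inverse_SumM[OF iso_arr_Ident iso_arr_symS]
        inverse_SumM[OF iso_arr_assocS iso_arr_Ident])

lemma interchange_typing [simp]:
  assumes "A \<in> Obj \<C>" "B \<in> Obj \<C>" "C \<in> Obj \<C>" "D \<in> Obj \<C>"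
  shows "\<sigma> A B C D \<in> Arr \<C>" "Dom \<C> (\<sigma> A B C D) = (A \<otimes> C \<oplus> A \<otimes> D) \<oplus> (B \<otimes> C \<oplus> B \<otimes> D)"
    "Cod \<C> (\<sigma> A B C D) = (A \<otimes> C \<oplus> B \<otimes> C) \<oplus> (A \<otimes> D \<oplus> B \<otimes> D)"
  using assms by (simp_all add: interchange_eq)

text \<open>With these two equations \<open>\<sigma>\<close> disappears from a composite in one
  rewrite, and its five factors need not be traced again.\<close>

lemma interchange_Pr:
  assumes [simp]: "A \<in> Obj \<C>" "B \<in> Obj \<C>" "C \<in> Obj \<C>" "D \<in> Obj \<C>"
  shows "\<sigma> A B C D \<Zsemi> p\<^sub>1 (A \<otimes> C \<oplus> B \<otimes> C) (A \<otimes> D \<oplus> B \<otimes> D)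
      = p\<^sub>1 (A \<otimes> C) (A \<otimes> D) \<oplus>\<^sub>m p\<^sub>1 (B \<otimes> C) (B \<otimes> D)" (is ?first)
    and "\<sigma> A B C D \<Zsemi> p\<^sub>2 (A \<otimes> C \<oplus> B \<otimes> C) (A \<otimes> D \<oplus> B \<otimes> D)
      = p\<^sub>2 (A \<otimes> C) (A \<otimes> D) \<oplus>\<^sub>m p\<^sub>2 (B \<otimes> C) (B \<otimes> D)" (is ?second)
proof -
  show ?first
    by (rule Pr_jointly_monic[of "A \<otimes> C" "B \<otimes> C"]) (simp_all add: interchange_eq)
  show ?second
    by (rule Pr_jointly_monic[of "A \<otimes> D" "B \<otimes> D"]) (simp_all add: interchange_eq)
qed

text \<open>Every one of the four components of either side is a tensor product of two projections.
  For \<open>A \<otimes> C\<close>, naturality turns the left side into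
  \<open>p\<^sub>1 A B \<otimes>\<^sub>m \<one> (C \<oplus> D)\<close>, the braiding of
  \<open>A\<close> with \<open>C \<oplus> D\<close>, its inverse, and
  \<open>\<one> A \<otimes>\<^sub>m p\<^sub>1 C D\<close>. On the right the braiding of
  \<open>A\<close> with \<open>C\<close> meets its inverse. Both collapse to
  \<open>p\<^sub>1 A B \<otimes>\<^sub>m p\<^sub>1 C D\<close>.\<close>

lemma distl_interchange:
  assumes [simp]: "A \<in> Obj \<C>" "B \<in> Obj \<C>" "C \<in> Obj \<C>" "D \<in> Obj \<C>"
  shows "\<gamma>\<^sup>\<otimes> (A \<oplus> B) (C \<oplus> D) \<Zsemi> \<delta> (C \<oplus> D) A B
      \<Zsemi> (\<gamma>\<^sup>\<otimes> A (C \<oplus> D) \<oplus>\<^sub>m \<gamma>\<^sup>\<otimes> B (C \<oplus> D))\<^sup>-\<^sup>1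
      \<Zsemi> (\<delta> A C D \<oplus>\<^sub>m \<delta> B C D) \<Zsemi> \<sigma> A B C D
    = \<delta> (A \<oplus> B) C D \<Zsemi> (\<gamma>\<^sup>\<otimes> (A \<oplus> B) C \<oplus>\<^sub>m \<gamma>\<^sup>\<otimes> (A \<oplus> B) D)
      \<Zsemi> (\<delta> C A B \<oplus>\<^sub>m \<delta> D A B)
      \<Zsemi> ((\<gamma>\<^sup>\<otimes> A C \<oplus>\<^sub>m \<gamma>\<^sup>\<otimes> B C) \<oplus>\<^sub>m (\<gamma>\<^sup>\<otimes> A D \<oplus>\<^sub>m \<gamma>\<^sup>\<otimes> B D))\<^sup>-\<^sup>1"
  (is "?l = ?r")
proof -
  note [simp] = interchange_Pr inverse_SumM[OF braidT_iso braidT_iso]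
    inverse_SumM[OF iso_arr_SumM[OF braidT_iso braidT_iso] iso_arr_SumM[OF braidT_iso braidT_iso]]
    iso_inverse_extend(1)[OF braidT_iso]
  have 1: "?l \<Zsemi> p\<^sub>1 (A \<otimes> C \<oplus> B \<otimes> C) (A \<otimes> D \<oplus> B \<otimes> D) = ?r \<Zsemi> p\<^sub>1 (A \<otimes> C \<oplus> B \<otimes> C) (A \<otimes> D \<oplus> B \<otimes> D)"
    by (rule Pr_jointly_monic[of "A \<otimes> C" "B \<otimes> C"]) simp_all
  have 2: "?l \<Zsemi> p\<^sub>2 (A \<otimes> C \<oplus> B \<otimes> C) (A \<otimes> D \<oplus> B \<otimes> D)
      = ?r \<Zsemi> p\<^sub>2 (A \<otimes> C \<oplus> B \<otimes> C) (A \<otimes> D \<oplus> B \<otimes> D)"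
    by (rule Pr_jointly_monic[of "A \<otimes> D" "B \<otimes> D"]) simp_all
  show ?thesis
    by (rule Pr_jointly_monic[OF _ _ _ _ _ _ _ 1 2]) simp_all
qed

section \<open>Equations between morphisms into zero objects\<close>

lemma annih_TensorO:
  assumes [simp]: "A \<in> Obj \<C>" "B \<in> Obj \<C>"
  shows "\<epsilon> (A \<otimes> B) = \<alpha>\<^sup>\<otimes> A B \<zero> \<Zsemi> (\<one> A \<otimes>\<^sub>m \<epsilon> B) \<Zsemi> \<epsilon> A"
  by (rule zero_object_into_unique[OF zero_object_ZeroO]) simp_all

lemma annih_UnitO: "\<epsilon> \<I> = \<lambda>\<^sup>\<otimes> \<zero>"
  by (rule zero_object_into_unique[OF zero_object_ZeroO]) simp_all

lemma annih_SumO: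
  assumes [simp]: "A \<in> Obj \<C>" "B \<in> Obj \<C>"
  shows "\<epsilon> (A \<oplus> B) = \<gamma>\<^sup>\<otimes> (A \<oplus> B) \<zero> \<Zsemi> \<delta> \<zero> A B \<Zsemi> (\<gamma>\<^sup>\<otimes> A \<zero> \<oplus>\<^sub>m \<gamma>\<^sup>\<otimes> B \<zero>)\<^sup>-\<^sup>1
    \<Zsemi> (\<epsilon> A \<oplus>\<^sub>m \<epsilon> B) \<Zsemi> \<lambda>\<^sup>\<oplus> \<zero>"
  by (rule zero_object_into_unique[OF zero_object_ZeroO])
    \<comment> \<open>Both rewrites serve typing only: they make the domains and codomains of the
      inverse and of the unit isomorphism known.\<close>
    (simp_all add: inverse_SumM[OF braidT_iso braidT_iso] lunitS_def)

lemma double_braid_ZeroO: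
  assumes [simp]: "A \<in> Obj \<C>"
  shows "\<beta> A \<zero> = \<one> (A \<otimes> \<zero>)"
  by (rule zero_object_into_unique[OF zero_object_TensorO_right[OF assms]]) simp_all

lemma braidT_ZeroO: "\<gamma>\<^sup>\<otimes> \<zero> \<zero> = \<one> (\<zero> \<otimes> \<zero>)"
  by (rule zero_object_into_unique[OF zero_object_TensorO_right[OF ZeroO_Obj]]) simp_all

end

theorem theorem12:
  fixes \<C> :: "('o, 'm, 'x) bimonoidal_cat_scheme" (structure)
  assumes "abelian_category \<C>"
    and "chosen_biproducts \<C>"
    and "braided_monoidal_category \<C>"
    and "additive_tensor \<C>"
  shows "\<forall>A \<in> Obj \<C>. \<forall>B \<in> Obj \<C>. \<forall>C \<in> Obj \<C>. \<forall>D \<in> Obj \<C>.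
    \<comment> \<open>1\<close>
    \<alpha>\<^sup>\<oplus> (A \<oplus> B) C D \<Zsemi> \<alpha>\<^sup>\<oplus> A B (C \<oplus> D)
      = (\<alpha>\<^sup>\<oplus> A B C \<oplus>\<^sub>m \<one> D) \<Zsemi> \<alpha>\<^sup>\<oplus> A (B \<oplus> C) D \<Zsemi> (\<one> A \<oplus>\<^sub>m \<alpha>\<^sup>\<oplus> B C D) \<and>
    \<comment> \<open>2\<close>
    \<alpha>\<^sup>\<oplus> A B C \<Zsemi> \<gamma>\<^sup>\<oplus> A (B \<oplus> C) \<Zsemi> \<alpha>\<^sup>\<oplus> B C A
      = (\<gamma>\<^sup>\<oplus> A B \<oplus>\<^sub>m \<one> C) \<Zsemi> \<alpha>\<^sup>\<oplus> B A C \<Zsemi> (\<one> B \<oplus>\<^sub>m \<gamma>\<^sup>\<oplus> A C) \<and>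
    \<comment> \<open>3\<close>
    \<alpha>\<^sup>\<oplus> A \<zero> B \<Zsemi> (\<one> A \<oplus>\<^sub>m \<lambda>\<^sup>\<oplus> B) = \<rho>\<^sup>\<oplus> A \<oplus>\<^sub>m \<one> B \<and>
    \<comment> \<open>4\<close>
    \<gamma>\<^sup>\<oplus> A B \<Zsemi> \<gamma>\<^sup>\<oplus> B A = \<one> (A \<oplus> B) \<and>
    \<comment> \<open>5\<close>
    \<alpha>\<^sup>\<otimes> (A \<otimes> B) C D \<Zsemi> \<alpha>\<^sup>\<otimes> A B (C \<otimes> D)
      = (\<alpha>\<^sup>\<otimes> A B C \<otimes>\<^sub>m \<one> D) \<Zsemi> \<alpha>\<^sup>\<otimes> A (B \<otimes> C) D \<Zsemi> (\<one> A \<otimes>\<^sub>m \<alpha>\<^sup>\<otimes> B C D) \<and>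
    \<comment> \<open>6\<close>
    \<alpha>\<^sup>\<otimes> A B C \<Zsemi> \<gamma>\<^sup>\<otimes> A (B \<otimes> C) \<Zsemi> \<alpha>\<^sup>\<otimes> B C A
      = (\<gamma>\<^sup>\<otimes> A B \<otimes>\<^sub>m \<one> C) \<Zsemi> \<alpha>\<^sup>\<otimes> B A C \<Zsemi> (\<one> B \<otimes>\<^sub>m \<gamma>\<^sup>\<otimes> A C) \<and>
    \<comment> \<open>7\<close>
    \<alpha>\<^sup>\<otimes> A B C \<Zsemi> (\<gamma>\<^sup>\<otimes> (B \<otimes> C) A)\<^sup>-\<^sup>1 \<Zsemi> \<alpha>\<^sup>\<otimes> B C A
      = ((\<gamma>\<^sup>\<otimes> B A)\<^sup>-\<^sup>1 \<otimes>\<^sub>m \<one> C) \<Zsemi> \<alpha>\<^sup>\<otimes> B A C \<Zsemi> (\<one> B \<otimes>\<^sub>m (\<gamma>\<^sup>\<otimes> C A)\<^sup>-\<^sup>1) \<and>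
    \<comment> \<open>8\<close>
    \<alpha>\<^sup>\<otimes> A \<I> B \<Zsemi> (\<one> A \<otimes>\<^sub>m \<lambda>\<^sup>\<otimes> B) = \<rho>\<^sup>\<otimes> A \<otimes>\<^sub>m \<one> B \<and>
    \<comment> \<open>9\<close>
    \<delta> A B C \<Zsemi> (\<beta> A B \<oplus>\<^sub>m \<beta> A C) = \<beta> A (B \<oplus> C) \<Zsemi> \<delta> A B C \<and>
    \<beta> A \<zero> = \<one> (A \<otimes> \<zero>) \<and>
    \<comment> \<open>10\<close>
    \<delta> A B C = (\<one> A \<otimes>\<^sub>m \<gamma>\<^sup>\<oplus> B C) \<Zsemi> \<delta> A C B \<Zsemi> \<gamma>\<^sup>\<oplus> (A \<otimes> C) (A \<otimes> B) \<and>
    \<comment> \<open>11\<close>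
    (\<one> A \<otimes>\<^sub>m \<alpha>\<^sup>\<oplus> B C D) \<Zsemi> \<delta> A B (C \<oplus> D) \<Zsemi> (\<one> (A \<otimes> B) \<oplus>\<^sub>m \<delta> A C D)
      = \<delta> A (B \<oplus> C) D \<Zsemi> (\<delta> A B C \<oplus>\<^sub>m \<one> (A \<otimes> D)) \<Zsemi> \<alpha>\<^sup>\<oplus> (A \<otimes> B) (A \<otimes> C) (A \<otimes> D) \<and>
    \<comment> \<open>12\<close>
    \<delta> A B \<zero> \<Zsemi> (\<one> (A \<otimes> B) \<oplus>\<^sub>m \<epsilon> A) \<Zsemi> \<rho>\<^sup>\<oplus> (A \<otimes> B) = \<one> A \<otimes>\<^sub>m \<rho>\<^sup>\<oplus> B \<and>
    \<comment> \<open>13\<close>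
    \<alpha>\<^sup>\<otimes> A B (C \<oplus> D) \<Zsemi> (\<one> A \<otimes>\<^sub>m \<delta> B C D) \<Zsemi> \<delta> A (B \<otimes> C) (B \<otimes> D)
      = \<delta> (A \<otimes> B) C D \<Zsemi> (\<alpha>\<^sup>\<otimes> A B C \<oplus>\<^sub>m \<alpha>\<^sup>\<otimes> A B D) \<and>
    \<comment> \<open>14\<close>
    \<epsilon> (A \<otimes> B) = \<alpha>\<^sup>\<otimes> A B \<zero> \<Zsemi> (\<one> A \<otimes>\<^sub>m \<epsilon> B) \<Zsemi> \<epsilon> A \<and>
    \<comment> \<open>15\<close>
    \<delta> \<I> A B \<Zsemi> (\<lambda>\<^sup>\<otimes> A \<oplus>\<^sub>m \<lambda>\<^sup>\<otimes> B) = \<lambda>\<^sup>\<otimes> (A \<oplus> B) \<and>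
    \<comment> \<open>16\<close>
    \<epsilon> \<I> = \<lambda>\<^sup>\<otimes> \<zero> \<and>
    \<comment> \<open>17\<close>
    \<gamma>\<^sup>\<otimes> (A \<oplus> B) (C \<oplus> D) \<Zsemi> \<delta> (C \<oplus> D) A B
        \<Zsemi> (\<gamma>\<^sup>\<otimes> A (C \<oplus> D) \<oplus>\<^sub>m \<gamma>\<^sup>\<otimes> B (C \<oplus> D))\<^sup>-\<^sup>1
        \<Zsemi> (\<delta> A C D \<oplus>\<^sub>m \<delta> B C D) \<Zsemi> \<sigma> A B C D
      = \<delta> (A \<oplus> B) C D \<Zsemi> (\<gamma>\<^sup>\<otimes> (A \<oplus> B) C \<oplus>\<^sub>m \<gamma>\<^sup>\<otimes> (A \<oplus> B) D)
        \<Zsemi> (\<delta> C A B \<oplus>\<^sub>m \<delta> D A B)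
        \<Zsemi> ((\<gamma>\<^sup>\<otimes> A C \<oplus>\<^sub>m \<gamma>\<^sup>\<otimes> B C) \<oplus>\<^sub>m (\<gamma>\<^sup>\<otimes> A D \<oplus>\<^sub>m \<gamma>\<^sup>\<otimes> B D))\<^sup>-\<^sup>1 \<and>
    \<comment> \<open>18\<close>
    \<epsilon> (A \<oplus> B) = \<gamma>\<^sup>\<otimes> (A \<oplus> B) \<zero> \<Zsemi> \<delta> \<zero> A B \<Zsemi> (\<gamma>\<^sup>\<otimes> A \<zero> \<oplus>\<^sub>m \<gamma>\<^sup>\<otimes> B \<zero>)\<^sup>-\<^sup>1
        \<Zsemi> (\<epsilon> A \<oplus>\<^sub>m \<epsilon> B) \<Zsemi> \<lambda>\<^sup>\<oplus> \<zero> \<and>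
    \<gamma>\<^sup>\<otimes> \<zero> \<zero> = \<one> (\<zero> \<otimes> \<zero>)"
proof -
  interpret abelian_category \<C> by fact
  interpret chosen_biproducts \<C> by fact
  interpret braided_monoidal_category \<C> by fact
  interpret additive_tensor \<C> by fact
  \<comment> \<open>The combined locale adds no assumption of its own, so the interpretations in
    force discharge it.\<close>
  interpret additive_braided_category \<C> ..
  show ?thesis
    by (intro ballI conjI assocS_pentagon assocS_symS_hexagon assocS_unit_triangle symS_symS
        pentagon hexagon1 inverse_braidT_hexagon triangle distl_double_braid double_braid_ZeroO
        distl_symS distl_assocS distl_runitS distl_assocT annih_TensorO distl_lunitT annih_UnitO
        distl_interchange annih_SumO braidT_ZeroO)
qed

end
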